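(* The monomials in $\mathfrak{pvb}_n^!$ corresponding to Up-Down forests on $[n]=\{1,\dots,n\}$ form a basis of $\mathfrak{pvb}_n^!$ (each monomial determined up to sign).
   Context: $\mathfrak{pvb}_n^!$ is the graded $\mathbb{Q}$-algebra obtained as the quotient of the exterior algebra on degree-1 generators $r_{ij}$, $1\le i\ne j\le n$, by the ideal generated by $r_{ij}\wedge r_{ik}=r_{ij}\wedge r_{jk}-r_{ik}\wedge r_{kj}$, $r_{ik}\wedge r_{jk}=r_{ij}\wedge r_{jk}-r_{ji}\wedge r_{ik}$ (for $i,j,k$ distinct) and $r_{ij}\wedge r_{ji}=0$. A set of directed edges $(a,b)$ on $[n]$ corresponds to the monomial $\bigwedge r_{ab}$ over its edges. An Up tree on a finite set $S\subseteq\mathbb{N}$ is a set of $|S|-1$ directed edges $(a,b)$ with $a<b$, $a,b\in S$, forming a tree in which every element of $S$ other than $\min S$ has exactly one incoming edge (for $|S|=1$ it is empty); Up trees on $S$ are in bijection with cyclic orderings of $S$. A Down tree on a finite set $T\subseteq\mathbb{N}$ with minimum $\mu$ is the set of edges $(t,\mu)$, $t\in T\setminus\{\mu\}$. An Up-Down forest on $[n]$ is obtained by choosing an unordered set partition $[n]=S_1\sqcup\cdots\sqcup S_l$, an Up tree on each $S_i$, and an unordered set partition $\{\min S_1,\dots,\min S_l\}=M_1\sqcup\cdots\sqcup M_k$, and taking the union of the chosen Up trees with the Down trees on the $M_j$. *)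

theory Defs
  imports Complex_Main "HOL-Library.Disjoint_Sets"
begin

type_synonym edge = "nat \<times> nat"
(* an element of the exterior algebra over Q on generators r_e, written in the
   basis of increasing monomials e_A (A a finite set of generators) *)
type_synonym ext = "edge set \<Rightarrow> rat"

text \<open>Generators r_ij, 1 <= i /= j <= n.\<close>
definition gens :: "nat \<Rightarrow> edge set" where
  "gens n = {(i,j). i \<in> {1..n} \<and> j \<in> {1..n} \<and> i \<noteq> j}"

text \<open>Elements of the exterior algebra on the generators gens n.\<close>
definition ExtAlg :: "nat \<Rightarrow> ext set" where
  "ExtAlg n = {f. \<forall>A. f A \<noteq> 0 \<longrightarrow> A \<subseteq> gens n}"

text \<open>Fixed total order on generators (lexicographic) used to order monomials.\<close>
definition egt :: "edge \<Rightarrow> edge \<Rightarrow> bool" where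
  "egt e f \<longleftrightarrow> fst e > fst f \<or> (fst e = fst f \<and> snd e > snd f)"

definition ex_sign :: "edge set \<Rightarrow> edge set \<Rightarrow> rat" where
  "ex_sign A B = (-1) ^ card {(a,b). a \<in> A \<and> b \<in> B \<and> egt a b}"

text \<open>Wedge product: e_A \<and> e_B = 0 if A, B meet, else (-1)^inv(A,B) e_(A \<union> B).\<close>
definition wedge :: "ext \<Rightarrow> ext \<Rightarrow> ext" where
  "wedge f g = (\<lambda>C. \<Sum>A\<in>Pow C. f A * g (C - A) * ex_sign A (C - A))"

definition ext_add :: "ext \<Rightarrow> ext \<Rightarrow> ext" where
  "ext_add f g = (\<lambda>A. f A + g A)"

definition ext_diff :: "ext \<Rightarrow> ext \<Rightarrow> ext" where
  "ext_diff f g = (\<lambda>A. f A - g A)"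

text \<open>The monomial of a set of edges (increasing order), and the generator r_ij.\<close>
definition ext_mono :: "edge set \<Rightarrow> ext" where
  "ext_mono D = (\<lambda>A. if A = D then 1 else 0)"

definition r :: "nat \<Rightarrow> nat \<Rightarrow> ext" where
  "r i j = ext_mono {(i,j)}"

text \<open>Defining quadratic relations of pvb_n^!.\<close>
definition pvb_rels :: "nat \<Rightarrow> ext set" where
  "pvb_rels n =
    {ext_add (ext_diff (wedge (r i j) (r i k)) (wedge (r i j) (r j k))) (wedge (r i k) (r k j))
       | i j k. i \<in> {1..n} \<and> j \<in> {1..n} \<and> k \<in> {1..n} \<and> i \<noteq> j \<and> i \<noteq> k \<and> j \<noteq> k}
   \<union> {ext_add (ext_diff (wedge (r i k) (r j k)) (wedge (r i j) (r j k))) (wedge (r j i) (r i k))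
       | i j k. i \<in> {1..n} \<and> j \<in> {1..n} \<and> k \<in> {1..n} \<and> i \<noteq> j \<and> i \<noteq> k \<and> j \<noteq> k}
   \<union> {wedge (r i j) (r j i) | i j. i \<in> {1..n} \<and> j \<in> {1..n} \<and> i \<noteq> j}"

text \<open>Two-sided ideal of the exterior algebra generated by the relations.\<close>
inductive_set pvb_ideal :: "nat \<Rightarrow> ext set" for n where
  zero: "(\<lambda>_. 0) \<in> pvb_ideal n"
| gen: "\<rho> \<in> pvb_rels n \<Longrightarrow> x \<in> ExtAlg n \<Longrightarrow> y \<in> ExtAlg n \<Longrightarrow> wedge (wedge x \<rho>) y \<in> pvb_ideal n"
| add: "a \<in> pvb_ideal n \<Longrightarrow> b \<in> pvb_ideal n \<Longrightarrow> ext_add a b \<in> pvb_ideal n"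

text \<open>Up trees, Down trees, Up-Down forests.\<close>
definition up_tree :: "nat set \<Rightarrow> edge set \<Rightarrow> bool" where
  "up_tree S T \<longleftrightarrow> finite S \<and> S \<noteq> {} \<and>
     T \<subseteq> {(a,b). a \<in> S \<and> b \<in> S \<and> a < b} \<and>
     card T = card S - 1 \<and>
     (\<forall>b\<in>S. (Min S, b) \<in> T\<^sup>*) \<and>
     (\<forall>b\<in>S - {Min S}. \<exists>!a. (a,b) \<in> T)"

definition down_tree :: "nat set \<Rightarrow> edge set" where
  "down_tree M = {(t, Min M) | t. t \<in> M - {Min M}}"

definition up_down_forests :: "nat \<Rightarrow> edge set set" where
  "up_down_forests n =
    {F. \<exists>P U Q. partition_on {1..n} P \<and> (\<forall>S\<in>P. up_tree S (U S)) \<and>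
               partition_on (Min ` P) Q \<and>
               F = (\<Union>S\<in>P. U S) \<union> (\<Union>M\<in>Q. down_tree M)}"

end

theory Submission
  imports Defs "HOL-Library.Function_Algebras" "HOL-Library.Product_Lexorder"
begin

text \<open>An Up-Down forest is a forest in which every vertex \<open>b\<close> has at most one edge to a smaller
  vertex \<open>a\<close>; that edge may be directed either way if \<open>a\<close> is the minimum of its component, and
  must be \<open>(a, b)\<close> otherwise.  Hence a forest on \<open>[n + 1]\<close> is one on \<open>[n]\<close> together with at most one
  edge at \<open>n + 1\<close>.

  Spanning, by induction on \<open>n\<close>: the relations replace a product of two edges at \<open>n + 1\<close> by products
  with a single one, and an edge \<open>(n + 1, k)\<close> slides down to the minimum of the component of \<open>k\<close>.

  Independence: for a disjoint union \<open>L\<close> of chains on \<open>[n]\<close>, sending \<open>r\<^sub>a\<^sub>b\<close> to \<open>x\<^sub>b - x\<^sub>a\<close> if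
  \<open>a\<close> precedes \<open>b\<close> in \<open>L\<close>, and to \<open>0\<close> otherwise, respects the relations and gives a
  homomorphism to the exterior algebra on \<open>x\<^sub>1, \<dots>, x\<^sub>n\<close>, which is realised here by operators on its
  underlying space.  For any nonempty set of forests there are an \<open>L\<close> and a forest \<open>F\<close> of the set whose
  image is nonzero, while all others of at least the same size are killed.\<close>

section \<open>The exterior algebra and the ideal\<close>

text \<open>Polymorphic in the index type: it serves \<open>ext\<close> as well as the functions on
  vertex sets on which the edges act later.\<close>

definition scale :: "rat \<Rightarrow> ('a \<Rightarrow> rat) \<Rightarrow> 'a \<Rightarrow> rat" where
  "scale c f = (\<lambda>A. c * f A)"

lemma ext_add_eq: "ext_add f g = f + g"
  by (simp add: ext_add_def plus_fun_def)

lemma ext_diff_eq: "ext_diff f g = f - g"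
  by (simp add: ext_diff_def fun_diff_def)

lemma zero_ext_eq: "(\<lambda>_. 0) = (0::ext)"
  by (simp add: zero_fun_def)

lemma egt_iff: "egt e f \<longleftrightarrow> f < e"
  by (auto simp: egt_def less_prod_def)

lemma finite_gens: "finite (gens n)"
  by (rule finite_subset[of _ "{1..n} \<times> {1..n}"]) (auto simp: gens_def)

lemma gens_mono: "m \<le> n \<Longrightarrow> gens m \<subseteq> gens n"
  by (auto simp: gens_def)

section \<open>Inversion signs and associativity of the wedge product\<close>

lemma ex_sign_Un_left:
  assumes "finite A" "finite A'" "finite B" "A \<inter> A' = {}"
  shows "ex_sign (A \<union> A') B = ex_sign A B * ex_sign A' B"
proof -
  let ?S = "\<lambda>A. {(a,b). a \<in> A \<and> b \<in> B \<and> egt a b}"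
  have f: "finite (?S X)" if "finite X" for X
    by (rule finite_subset[of _ "X \<times> B"]) (use that assms in auto)
  have "?S (A \<union> A') = ?S A \<union> ?S A'" by auto
  moreover have "card (?S A \<union> ?S A') = card (?S A) + card (?S A')"
    by (rule card_Un_disjoint) (use assms f in auto)
  ultimately show ?thesis by (simp add: ex_sign_def power_add)
qed

lemma ex_sign_Un_right:
  assumes "finite A" "finite B" "finite B'" "B \<inter> B' = {}"
  shows "ex_sign A (B \<union> B') = ex_sign A B * ex_sign A B'"
proof -
  let ?S = "\<lambda>B. {(a,b). a \<in> A \<and> b \<in> B \<and> egt a b}"
  have f: "finite (?S X)" if "finite X" for X
    by (rule finite_subset[of _ "A \<times> X"]) (use that assms in auto)
  have "?S (B \<union> B') = ?S B \<union> ?S B'" by auto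
  moreover have "card (?S B \<union> ?S B') = card (?S B) + card (?S B')"
    by (rule card_Un_disjoint) (use assms f in auto)
  ultimately show ?thesis by (simp add: ex_sign_def power_add)
qed

lemma ex_sign_empty [simp]: "ex_sign {} B = 1" "ex_sign A {} = 1"
  by (simp_all add: ex_sign_def)

lemma ex_sign_cases: "ex_sign A B = 1 \<or> ex_sign A B = -1"
  unfolding ex_sign_def by (simp add: minus_one_power_iff)

lemma wedge_add_left: "wedge (f + f') g = wedge f g + wedge f' g"
  by (simp add: wedge_def fun_eq_iff distrib_right sum.distrib)

lemma wedge_add_right: "wedge f (g + g') = wedge f g + wedge f g'"
  by (simp add: wedge_def fun_eq_iff distrib_right distrib_left sum.distrib)

lemma wedge_diff_left: "wedge (f - f') g = wedge f g - wedge f' g"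
  by (simp add: wedge_def fun_eq_iff left_diff_distrib sum_subtractf)

lemma wedge_diff_right: "wedge f (g - g') = wedge f g - wedge f g'"
  by (simp add: wedge_def fun_eq_iff left_diff_distrib right_diff_distrib sum_subtractf)

lemma wedge_scale_left: "wedge (scale c f) g = scale c (wedge f g)"
  by (simp add: wedge_def scale_def fun_eq_iff sum_distrib_left mult.assoc)

lemma wedge_scale_right: "wedge f (scale c g) = scale c (wedge f g)"
  by (simp add: wedge_def scale_def fun_eq_iff sum_distrib_left mult_ac)

lemma wedge_zero_left [simp]: "wedge 0 g = 0"
  by (simp add: wedge_def fun_eq_iff)

lemma wedge_zero_right [simp]: "wedge f 0 = 0"
  by (simp add: wedge_def fun_eq_iff)

text \<open>Since \<open>ex_sign\<close> is multiplicative over disjoint unions in either argument,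
  both sides become the sum over ordered splittings of \<open>C\<close> into three parts, weighted
  by the product of the three pairwise signs.\<close>

lemma wedge_assoc: "wedge (wedge f g) h = wedge f (wedge g h)"
proof
  fix C :: "edge set"
  show "wedge (wedge f g) h C = wedge f (wedge g h) C"
  proof (cases "finite C")
    case False
    \<comment> \<open>The index set \<open>Pow C\<close> is infinite, so both sums take the default
      value 0.\<close>
    then show ?thesis by (simp add: wedge_def)
  next
    case True
    let ?t = "\<lambda>X Y Z. f X * g Y * h Z * (ex_sign X Y * ex_sign X Z * ex_sign Y Z)"
    have comp: "C - X - (A - X) = C - A" if "X \<subseteq> A" for X A
      using that by auto
    have "wedge (wedge f g) h C =
        (\<Sum>A\<in>Pow C. \<Sum>X\<in>Pow A. f X * g (A - X) * ex_sign X (A - X) * h (C - A) * ex_sign A (C - A))"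
      by (simp add: wedge_def sum_distrib_right)
    also have "\<dots> = (\<Sum>A\<in>Pow C. \<Sum>X\<in>Pow A. ?t X (A - X) (C - A))"
    proof (intro sum.cong refl)
      fix A X assume a: "A \<in> Pow C" "X \<in> Pow A"
      then have "finite A" "finite X" "finite (A - X)" "finite (C - A)"
        using True by (auto intro: finite_subset)
      then have "ex_sign (X \<union> (A - X)) (C - A) = ex_sign X (C - A) * ex_sign (A - X) (C - A)"
        by (intro ex_sign_Un_left) auto
      moreover have "X \<union> (A - X) = A" using a by auto
      ultimately show "f X * g (A - X) * ex_sign X (A - X) * h (C - A) * ex_sign A (C - A)
          = ?t X (A - X) (C - A)" by simp
    qed
    also have "\<dots> = (\<Sum>(A,X)\<in>(SIGMA A:Pow C. Pow A). ?t X (A - X) (C - A))"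
      using True by (subst sum.Sigma) (auto intro: finite_subset)
    \<comment> \<open>Choosing \<open>A\<close> and then \<open>X\<close> inside \<open>A\<close>
      amounts to choosing \<open>X\<close> and then \<open>Y = A - X\<close> outside
      \<open>X\<close>.\<close>
    also have "\<dots> = (\<Sum>(X,Y)\<in>(SIGMA X:Pow C. Pow (C - X)). ?t X Y (C - X - Y))"
      by (rule sum.reindex_bij_witness[where i = "\<lambda>(X,Y). (X \<union> Y, X)" and j = "\<lambda>(A,X). (X, A - X)"])
        (auto simp: Un_absorb1 comp)
    also have "\<dots> = (\<Sum>X\<in>Pow C. \<Sum>Y\<in>Pow (C - X). ?t X Y (C - X - Y))"
      using True by (subst sum.Sigma) auto
    also have "\<dots> = (\<Sum>X\<in>Pow C. \<Sum>Y\<in>Pow (C - X).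
        f X * (g Y * h (C - X - Y) * ex_sign Y (C - X - Y)) * ex_sign X (C - X))"
    proof (intro sum.cong refl)
      fix X Y assume a: "X \<in> Pow C" "Y \<in> Pow (C - X)"
      then have "finite X" "finite Y" "finite (C - X - Y)"
        using True by (auto intro: finite_subset)
      then have "ex_sign X (Y \<union> (C - X - Y)) = ex_sign X Y * ex_sign X (C - X - Y)"
        by (intro ex_sign_Un_right) auto
      moreover have "Y \<union> (C - X - Y) = C - X" using a by auto
      ultimately show "?t X Y (C - X - Y) =
          f X * (g Y * h (C - X - Y) * ex_sign Y (C - X - Y)) * ex_sign X (C - X)" by simp
    qed
    also have "\<dots> = wedge f (wedge g h) C"
      by (simp add: wedge_def sum_distrib_left sum_distrib_right)
    finally show ?thesis .
  qed
qed

lemma wedge_mono: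
  assumes "finite A" "finite B"
  shows "wedge (ext_mono A) (ext_mono B) =
    (if A \<inter> B = {} then scale (ex_sign A B) (ext_mono (A \<union> B)) else 0)"
proof
  fix C
  show "wedge (ext_mono A) (ext_mono B) C =
    (if A \<inter> B = {} then scale (ex_sign A B) (ext_mono (A \<union> B)) else 0) C"
  proof (cases "finite C")
    case False
    then have "C \<noteq> A \<union> B" using assms by auto
    then show ?thesis using False by (simp add: wedge_def scale_def ext_mono_def)
  next
    case True
    have "wedge (ext_mono A) (ext_mono B) C =
      (\<Sum>X\<in>Pow C. if X = A then (if C - A = B then ex_sign A B else 0) else 0)"
      unfolding wedge_def by (rule sum.cong) (auto simp: ext_mono_def)
    also have "\<dots> = (if A \<subseteq> C then (if C - A = B then ex_sign A B else 0) else 0)"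
      using True by (subst sum.delta) auto
    also have "\<dots> = (if A \<inter> B = {} then scale (ex_sign A B) (ext_mono (A \<union> B)) else 0) C"
      by (auto simp: scale_def ext_mono_def)
    finally show ?thesis .
  qed
qed

lemma ext_mono_in: "A \<subseteq> gens n \<Longrightarrow> ext_mono A \<in> ExtAlg n"
  by (auto simp: ExtAlg_def ext_mono_def)

lemma ExtAlg_scale: "f \<in> ExtAlg n \<Longrightarrow> scale c f \<in> ExtAlg n"
  by (auto simp: ExtAlg_def scale_def)

lemma ExtAlg_wedge:
  assumes "f \<in> ExtAlg n" "g \<in> ExtAlg n"
  shows "wedge f g \<in> ExtAlg n"
  unfolding ExtAlg_def
proof (safe, rule ccontr)
  fix A a b assume nz: "wedge f g A \<noteq> 0" and ab: "(a, b) \<in> A" "(a, b) \<notin> gens n"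
  have "f X * g (A - X) * ex_sign X (A - X) = 0" if "X \<in> Pow A" for X
    using assms ab that by (cases "(a,b) \<in> X") (auto simp: ExtAlg_def)
  then have "wedge f g A = 0"
    unfolding wedge_def by (rule sum.neutral[OF ballI])
  then show False using nz by simp
qed

lemma sum_apply: "(\<Sum>i\<in>I. f i) x = (\<Sum>i\<in>I. f i x)" for f :: "'i \<Rightarrow> 'a \<Rightarrow> 'b::comm_monoid_add"
  by (induction I rule: infinite_finite_induct) auto

lemma ext_expand:
  assumes "f \<in> ExtAlg n"
  shows "f = (\<Sum>A\<in>Pow (gens n). scale (f A) (ext_mono A))"
proof
  fix B
  have "(\<Sum>A\<in>Pow (gens n). scale (f A) (ext_mono A)) B =
      (\<Sum>A\<in>Pow (gens n). if A = B then f B else 0)"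
    by (simp add: sum_apply scale_def ext_mono_def) (rule sum.cong, auto)
  also have "\<dots> = f B"
    using assms by (subst sum.delta) (auto simp: finite_gens ExtAlg_def)
  finally show "f B = (\<Sum>A\<in>Pow (gens n). scale (f A) (ext_mono A)) B" by simp
qed

section \<open>Closure properties of the ideal\<close>

lemma pvb_ideal_scale:
  assumes "a \<in> pvb_ideal n"
  shows "scale c a \<in> pvb_ideal n"
  using assms
proof induction
  case zero
  show ?case using pvb_ideal.zero[of n] by (simp add: scale_def)
next
  case (gen \<rho> x y)
  then show ?case
    using pvb_ideal.gen[of \<rho> n "scale c x" y] by (simp add: wedge_scale_left ExtAlg_scale)
next
  case (add a b)
  moreover have "scale c (ext_add a b) = ext_add (scale c a) (scale c b)"
    by (simp add: scale_def ext_add_def distrib_left)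
  ultimately show ?case by (simp add: pvb_ideal.add)
qed

lemma pvb_rels_mono: "m \<le> n \<Longrightarrow> pvb_rels m \<subseteq> pvb_rels n"
proof -
  assume "m \<le> n"
  then have sub: "i \<in> {1..n}" if "i \<in> {1..m}" for i using that by simp
  show ?thesis
    unfolding pvb_rels_def
    by (intro Un_mono subsetI; elim CollectE exE conjE; intro CollectI exI conjI) (assumption | erule sub)+
qed

lemma ExtAlg_mono: "m \<le> n \<Longrightarrow> ExtAlg m \<subseteq> ExtAlg n"
  unfolding ExtAlg_def using gens_mono[of m n] by blast

text \<open>Associativity absorbs \<open>z\<close> into the right cofactor. The passage from
  \<open>m\<close> to \<open>n\<close> allows congruences on fewer vertices to be multiplied by
  edges at new ones.\<close>

lemma pvb_ideal_wedge_right: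
  assumes "a \<in> pvb_ideal m" "m \<le> n" "z \<in> ExtAlg n"
  shows "wedge a z \<in> pvb_ideal n"
  using assms(1)
proof induction
  case zero
  then show ?case using pvb_ideal.zero[of n] by (simp add: zero_ext_eq)
next
  case (gen \<rho> x y)
  have "\<rho> \<in> pvb_rels n" "x \<in> ExtAlg n" "y \<in> ExtAlg n"
    using gen pvb_rels_mono[OF assms(2)] ExtAlg_mono[OF assms(2)] by blast+
  then show ?case
    using pvb_ideal.gen[of \<rho> n x "wedge y z"] ExtAlg_wedge[OF _ assms(3)] by (simp add: wedge_assoc)
next
  case (add a b)
  show ?case using pvb_ideal.add[OF add.IH] unfolding ext_add_eq wedge_add_left .
qed

section \<open>Up-Down forests as increasing forests\<close>

definition etop :: "edge \<Rightarrow> nat" where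
  "etop e = max (fst e) (snd e)"

text \<open>Every edge is charged to its larger endpoint, and no vertex is charged twice. The
  vertices that are not charged are the minima of the components, so the last clause makes every
  downward edge end at such a minimum.\<close>

definition inc_forest :: "nat \<Rightarrow> edge set \<Rightarrow> bool" where
  "inc_forest n F \<longleftrightarrow> F \<subseteq> gens n \<and> inj_on etop F \<and>
     (\<forall>t m. (t, m) \<in> F \<and> m < t \<longrightarrow> m \<notin> etop ` F)"

text \<open>An Up edge is charged to its head, which is never a block minimum (\<open>f1\<close>),
  while both ends of a Down edge are block minima (\<open>f2\<close>). Hence two edges with the same
  top are of the same kind, and then they lie in the same tree, where the edge is determined by its
  top.\<close>

lemma up_down_forest_inc_forest:
  assumes "F \<in> up_down_forests n"
  shows "inc_forest n F"
proof -
  obtain P U Q where P: "partition_on {1..n} P" and U: "\<And>S. S \<in> P \<Longrightarrow> up_tree S (U S)"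
    and Q: "partition_on (Min ` P) Q" and F: "F = (\<Union>S\<in>P. U S) \<union> (\<Union>M\<in>Q. down_tree M)"
    using assms unfolding up_down_forests_def by blast
  have Sub: "S \<subseteq> {1..n}" "finite S" "S \<noteq> {}" if "S \<in> P" for S
    using P that U[OF that] by (auto simp: partition_on_def up_tree_def)
  have Psame: "S = S'" if "S \<in> P" "S' \<in> P" "b \<in> S" "b \<in> S'" for S S' b
    using P that by (auto simp: partition_on_def disjoint_def)
  have Qsame: "M = M'" if "M \<in> Q" "M' \<in> Q" "b \<in> M" "b \<in> M'" for M M' b
    using Q that by (auto simp: partition_on_def disjoint_def)
  have finP: "finite P" using P finite_elements by blast
  have MQ: "M \<subseteq> Min ` P" "finite M" "M \<noteq> {}" if "M \<in> Q" for M
    using Q that finP by (auto simp: partition_on_def intro: finite_subset)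
  have MinP: "Min ` P \<subseteq> {1..n}"
  proof
    fix x assume "x \<in> Min ` P"
    then obtain S where "S \<in> P" "x = Min S" by blast
    then show "x \<in> {1..n}" using Sub[of S] Min_in[of S] by blast
  qed
  have edge: "(a < b \<and> (\<exists>S\<in>P. (a, b) \<in> U S \<and> a \<in> S \<and> b \<in> S \<and> b \<noteq> Min S)) \<or>
      (b < a \<and> (\<exists>M\<in>Q. a \<in> M \<and> b \<in> M \<and> b = Min M))" if "(a, b) \<in> F" for a b
  proof -
    from that consider S where "S \<in> P" "(a, b) \<in> U S" | M where "M \<in> Q" "(a, b) \<in> down_tree M"
      unfolding F by blast
    then show ?thesis
    proof cases
      case 1
      then have ab: "a < b" "a \<in> S" "b \<in> S" using U[OF 1(1)] by (auto simp: up_tree_def)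
      then have "Min S \<le> a" using Sub[OF 1(1)] by simp
      then show ?thesis using 1 ab by auto
    next
      case 2
      then have ab: "a \<in> M" "a \<noteq> Min M" "b = Min M" by (auto simp: down_tree_def)
      moreover have "Min M \<in> M" "Min M \<le> a" using MQ[OF 2(1)] ab by auto
      ultimately show ?thesis using 2 by auto
    qed
  qed
  have up: "\<exists>S\<in>P. (a, b) \<in> U S \<and> a \<in> S \<and> b \<in> S \<and> b \<noteq> Min S" if "(a, b) \<in> F" "a < b" for a b
    using edge[OF that(1)] that(2) by auto
  have down: "\<exists>M\<in>Q. a \<in> M \<and> b \<in> M \<and> b = Min M" if "(a, b) \<in> F" "b < a" for a b
    using edge[OF that(1)] that(2) by auto
  have f1: "b \<notin> Min ` P" if ab: "(a, b) \<in> F" "a < b" for a b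
  proof
    assume "b \<in> Min ` P"
    then obtain S' where S': "S' \<in> P" "b = Min S'" by blast
    obtain S where S: "S \<in> P" "b \<in> S" "b \<noteq> Min S" using up[OF ab] by blast
    have "b \<in> S'" using S' Sub[OF S'(1)] by simp
    then show False using Psame[OF S(1) S'(1) S(2)] S' S by simp
  qed
  have f2: "t \<in> Min ` P \<and> m \<in> Min ` P" if "(t, m) \<in> F" "m < t" for t m
    using down[OF that] MQ(1) by blast
  show ?thesis
    unfolding inc_forest_def
  proof (intro conjI allI impI)
    show "F \<subseteq> gens n"
    proof (rule subrelI)
      fix a b assume "(a, b) \<in> F"
      then have "a \<noteq> b" "a \<in> {1..n} \<and> b \<in> {1..n}"
        using edge[of a b] Sub(1) MQ(1) MinP by blast+
      then show "(a, b) \<in> gens n" by (simp add: gens_def)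
    qed
    show "inj_on etop F"
    proof (rule inj_onI)
      fix e e' assume e: "e \<in> F" "e' \<in> F" "etop e = etop e'"
      obtain a b c d where ab: "e = (a, b)" "e' = (c, d)" by fastforce
      have "a \<noteq> b" "c \<noteq> d" using edge e ab by blast+
      then consider "a < b" "c < d" | "a < b" "d < c" | "b < a" "c < d" | "b < a" "d < c"
        by linarith
      then show "e = e'"
      proof cases
        case 1
        then have [simp]: "d = b" using e ab by (auto simp: etop_def)
        obtain S where S: "S \<in> P" "(a, b) \<in> U S" "b \<in> S" "b \<noteq> Min S" using up[of a b] 1 e ab by blast
        obtain S' where S': "S' \<in> P" "(c, b) \<in> U S'" "b \<in> S'" using up[of c d] 1 e ab by auto
        have "S' = S" using Psame S S' by blast
        moreover have "\<exists>!x. (x, b) \<in> U S" using S U[OF S(1)] by (simp add: up_tree_def)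
        ultimately show ?thesis using S S' ab by auto
      next
        case 2
        then have "c = b" using e ab by (auto simp: etop_def)
        then show ?thesis using f1[of a b] f2[of c d] 2 e ab by auto
      next
        case 3
        then have "d = a" using e ab by (auto simp: etop_def)
        then show ?thesis using f1[of c d] f2[of a b] 3 e ab by auto
      next
        case 4
        then have [simp]: "c = a" using e ab by (auto simp: etop_def)
        obtain M where M: "M \<in> Q" "a \<in> M" "b = Min M" using down[of a b] 4 e ab by blast
        obtain M' where M': "M' \<in> Q" "a \<in> M'" "d = Min M'" using down[of c d] 4 e ab by auto
        have "M' = M" using Qsame M M' by blast
        then show ?thesis using M M' ab by simp
      qed
    qed
    fix t m assume tm: "(t, m) \<in> F \<and> m < t"
    show "m \<notin> etop ` F"
    proof
      assume "m \<in> etop ` F"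
      then obtain a b where ab: "(a, b) \<in> F" "m = etop (a, b)" by auto
      consider "a < b" | "b < a" using edge[OF ab(1)] by blast
      then show False
      proof cases
        case 1
        then show ?thesis using f1[of a b] f2[of t m] tm ab by (simp add: etop_def)
      next
        case 2
        then have [simp]: "m = a" using ab by (simp add: etop_def)
        obtain M where M: "M \<in> Q" "m \<in> M" "m = Min M" using down[of t m] tm by blast
        obtain M' where M': "M' \<in> Q" "a \<in> M'" "b = Min M'" using down[of a b] 2 ab by auto
        have "M' = M" using Qsame M M' by auto
        then show ?thesis using M M' 2 by simp
      qed
    qed
  qed
qed

text \<open>The upward and the downward edges are separated; the blocks are the sets reachable by
  upward edges from their roots, and the roots are grouped by the target of their downward
  edge.\<close>

lemma inc_forest_up_down_forest:
  assumes "inc_forest n F"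
  shows "F \<in> up_down_forests n"
proof -
  have Fg: "F \<subseteq> gens n" and inj: "inj_on etop F"
    and root: "\<And>t m. (t, m) \<in> F \<Longrightarrow> m < t \<Longrightarrow> m \<notin> etop ` F"
    using assms by (auto simp: inc_forest_def)
  define Up where "Up = {(a, b) \<in> F. a < b}"
  define Dn where "Dn = {(t, m) \<in> F. m < t}"
  \<comment> \<open>\<open>R\<close> will be the set of minima of the Up trees and \<open>T\<close>
    the set of those that are also minima of Down trees; \<open>S r\<close> and \<open>M m\<close>
    are the vertex sets of these trees.\<close>
  define R where "R = {r \<in> {1..n}. \<forall>a. (a, r) \<notin> Up}"
  define T where "T = {t \<in> R. \<forall>m. (t, m) \<notin> Dn}"
  define S where "S r = {b. (r, b) \<in> Up\<^sup>*}" for r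
  define M where "M m = insert m {t. (t, m) \<in> Dn}" for m
  have F_eq: "F = Up \<union> Dn"
    using Fg unfolding Up_def Dn_def gens_def by fastforce
  have UpI: "a \<in> {1..n}" "b \<in> {1..n}" "a < b" if "(a, b) \<in> Up" for a b
    using that Fg by (auto simp: Up_def gens_def)
  have DnI: "a \<in> {1..n}" "b \<in> {1..n}" "b < a" if "(a, b) \<in> Dn" for a b
    using that Fg by (auto simp: Dn_def gens_def)
  have UpUp: "a = a'" if "(a, b) \<in> Up" "(a', b) \<in> Up" for a a' b
    using inj_onD[OF inj, of "(a, b)" "(a', b)"] that by (auto simp: Up_def etop_def)
  have DnDn: "a = a'" if "(b, a) \<in> Dn" "(b, a') \<in> Dn" for a a' b
    using inj_onD[OF inj, of "(b, a)" "(b, a')"] that by (auto simp: Dn_def etop_def)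
  have UpDn: False if "(a, b) \<in> Up" "(b, c) \<in> Dn" for a b c
    using inj_onD[OF inj, of "(a, b)" "(b, c)"] that by (auto simp: Up_def Dn_def etop_def)
  have DnT: "m \<in> T" if "(t, m) \<in> Dn" for t m
  proof -
    have "m \<notin> etop ` F" using root that by (auto simp: Dn_def)
    then have "(a, m) \<notin> Up" "(m, a) \<notin> Dn" for a
      by (force simp: Up_def Dn_def etop_def image_iff)+
    then show ?thesis using DnI[OF that] by (simp add: T_def R_def)
  qed
  have DnR: "t \<in> R" if "(t, m) \<in> Dn" for t m
    using UpDn[OF _ that] DnI[OF that] by (auto simp: R_def)
  have le: "a \<le> b" "b \<in> {1..n}" if "(a, b) \<in> Up\<^sup>*" "a \<in> {1..n}" for a b
    using that by (induction rule: rtrancl_induct) (use UpI in fastforce)+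
  \<comment> \<open>By \<open>UpUp\<close> the way back along upward edges is deterministic, and it
    ends at a vertex of \<open>R\<close>; this makes the blocks disjoint.\<close>
  have root_unique: "a = a'" if "(a, b) \<in> Up\<^sup>*" "(a', b) \<in> Up\<^sup>*" "a \<in> R" "a' \<in> R" for a a' b
    using that(1,2)
  proof (induction rule: rtrancl_induct)
    case base
    then show ?case using that by (auto simp: R_def elim: rtranclE)
  next
    case (step y z)
    from step.prems show ?case
    proof (cases rule: rtranclE)
      case base
      then show ?thesis using step.hyps that by (auto simp: R_def)
    next
      case (step y')
      then show ?thesis using UpUp step.IH \<open>(y, z) \<in> Up\<close> by blast
    qed
  qed
  have root_ex: "\<exists>a\<in>R. (a, b) \<in> Up\<^sup>*" if "b \<in> {1..n}" for b
    using that
  proof (induction b rule: less_induct)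
    case (less b)
    show ?case
    proof (cases "b \<in> R")
      case False
      then obtain a where a: "(a, b) \<in> Up" using less.prems by (auto simp: R_def)
      then obtain a' where "a' \<in> R" "(a', a) \<in> Up\<^sup>*" using less.IH[of a] UpI[OF a] by blast
      then show ?thesis using a by (meson rtrancl.rtrancl_into_rtrancl)
    qed auto
  qed
  have Rn: "a \<in> {1..n}" if "a \<in> R" for a using that by (simp add: R_def)
  have S_sub: "S a \<subseteq> {1..n}" "finite (S a)" if "a \<in> R" for a
    using le(2) Rn that finite_subset[of "S a" "{1..n}"] unfolding S_def by blast+
  have MinS: "Min (S a) = a" if "a \<in> R" for a
    using S_sub[OF that] le(1)[OF _ Rn[OF that]] by (intro Min_eqI) (auto simp: S_def)
  have MinM: "Min (M m) = m" "finite (M m)" for m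
  proof -
    show "finite (M m)"
      by (rule finite_subset[of _ "insert m {1..n}"]) (use DnI(1) in \<open>auto simp: M_def\<close>)
    then show "Min (M m) = m"
      by (intro Min_eqI) (use DnI(3) less_imp_le in \<open>fastforce simp: M_def\<close>)+
  qed
  have partP: "partition_on {1..n} (S ` R)"
    unfolding partition_on_def disjoint_def
  proof (intro conjI ballI impI)
    show "\<Union> (S ` R) = {1..n}"
      using S_sub root_ex unfolding S_def by blast
    show "A \<inter> B = {}" if "A \<in> S ` R" "B \<in> S ` R" "A \<noteq> B" for A B
      using that root_unique unfolding S_def by blast
    show "{} \<notin> S ` R" unfolding S_def by blast
  qed
  have MinP: "Min ` (S ` R) = R"
    using MinS by (force simp: image_iff)
  have partQ: "partition_on R (M ` T)"
    unfolding partition_on_def disjoint_def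
  proof (intro conjI ballI impI)
    show "\<Union> (M ` T) = R"
    proof
      show "\<Union> (M ` T) \<subseteq> R" using DnR by (auto simp: M_def T_def)
      show "R \<subseteq> \<Union> (M ` T)"
      proof
        fix t assume t: "t \<in> R"
        show "t \<in> \<Union> (M ` T)"
        proof (cases "t \<in> T")
          case False
          then obtain m where "(t, m) \<in> Dn" using t by (auto simp: T_def)
          then show ?thesis using DnT unfolding M_def by blast
        qed (auto simp: M_def)
      qed
    qed
    show "A \<inter> B = {}" if "A \<in> M ` T" "B \<in> M ` T" "A \<noteq> B" for A B
      using that DnDn by (auto simp: M_def T_def)
    show "{} \<notin> M ` T" unfolding M_def by blast
  qed
  have tree: "up_tree (S a) (Up \<inter> S a \<times> S a)" if a: "a \<in> R" for a
    unfolding up_tree_def MinS[OF a]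
  proof (intro conjI ballI)
    let ?U = "Up \<inter> S a \<times> S a"
    show "finite (S a)" using S_sub a by blast
    have aS: "a \<in> S a" by (simp add: S_def)
    then show "S a \<noteq> {}" by blast
    show "?U \<subseteq> {(c, b). c \<in> S a \<and> b \<in> S a \<and> c < b}" using UpI by blast
    have pre: "\<exists>c. (c, b) \<in> ?U" if "b \<in> S a - {a}" for b
      using that unfolding S_def by (auto elim: rtranclE)
    show "\<exists>!c. (c, b) \<in> ?U" if "b \<in> S a - {a}" for b
      using pre[OF that] UpUp by blast
    \<comment> \<open>The edges are counted by their heads, which are all vertices of the block
      except the root.\<close>
    have "inj_on snd ?U" by (rule inj_onI) (use UpUp in auto)
    moreover have "snd ` ?U = S a - {a}"
      using pre a by (force simp: R_def)
    ultimately have "card ?U = card (S a - {a})" by (metis card_image)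
    then show "card ?U = card (S a) - 1" using aS S_sub[OF a] by simp
    show "(a, b) \<in> ?U\<^sup>*" if "b \<in> S a" for b
    proof -
      have "(a, b) \<in> Up\<^sup>*" using that by (simp add: S_def)
      then show ?thesis
      proof (induction rule: rtrancl_induct)
        case (step y z)
        then have "(y, z) \<in> ?U" by (auto simp: S_def)
        then show ?case using step.IH by (rule rtrancl_into_rtrancl[rotated])
      qed simp
    qed
  qed
  have "F = (\<Union>X\<in>S ` R. Up \<inter> X \<times> X) \<union> (\<Union>X\<in>M ` T. down_tree X)"
  proof -
    have "Up \<subseteq> (\<Union>X\<in>S ` R. Up \<inter> X \<times> X)"
    proof (rule subrelI)
      fix a b assume ab: "(a, b) \<in> Up"
      then obtain c where c: "c \<in> R" "(c, a) \<in> Up\<^sup>*" using root_ex UpI by blast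
      then have "(c, b) \<in> Up\<^sup>*" using ab by simp
      then show "(a, b) \<in> (\<Union>X\<in>S ` R. Up \<inter> X \<times> X)" using ab c by (auto simp: S_def)
    qed
    moreover have "down_tree (M m) = {(t, m) | t. (t, m) \<in> Dn}" for m
      using DnI(3) unfolding down_tree_def MinM by (auto simp: M_def)
    then have "(\<Union>X\<in>M ` T. down_tree X) = Dn"
      using DnT by auto
    ultimately show ?thesis unfolding F_eq by blast
  qed
  then show ?thesis
    unfolding up_down_forests_def using partP partQ tree MinP
    by (intro CollectI exI[of _ "S ` R"] exI[of _ "\<lambda>X. Up \<inter> X \<times> X"] exI[of _ "M ` T"]) auto
qed

lemma up_down_forests_eq: "up_down_forests n = {F. inc_forest n F}"
  using up_down_forest_inc_forest inc_forest_up_down_forest by blast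

lemma finite_inc_forests: "finite {F. inc_forest n F}"
  by (rule finite_subset[of _ "Pow (gens n)"]) (auto simp: inc_forest_def finite_gens)

lemma inc_forest_finite: "inc_forest n F \<Longrightarrow> finite F"
  using finite_gens finite_subset by (auto simp: inc_forest_def)

lemma etop_gens: "e \<in> gens n \<Longrightarrow> etop e \<le> n"
  by (auto simp: gens_def etop_def)

section \<open>Adding and removing the largest vertex\<close>

lemma inc_forest_Suc: "inc_forest n F \<Longrightarrow> inc_forest (Suc n) F"
  using gens_mono[of n "Suc n"] by (auto simp: inc_forest_def)

text \<open>The top \<open>Suc n\<close> is new and no edge of \<open>F\<close> ends there, so only
  the new edge itself can violate the condition on downward edges.\<close>

lemma inc_forest_insert:
  assumes F: "inc_forest n F"
    and e: "(a, b) \<in> gens (Suc n)" "etop (a, b) = Suc n" "b < a \<Longrightarrow> b \<notin> etop ` F"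
  shows "inc_forest (Suc n) (insert (a, b) F)"
  unfolding inc_forest_def
proof (intro conjI allI impI)
  have Fg: "F \<subseteq> gens n" and inj: "inj_on etop F"
    and down: "\<And>t m. (t, m) \<in> F \<Longrightarrow> m < t \<Longrightarrow> m \<notin> etop ` F"
    using F by (auto simp only: inc_forest_def)
  have new: "Suc n \<notin> etop ` F" using Fg etop_gens by fastforce
  show "insert (a, b) F \<subseteq> gens (Suc n)"
    using e Fg gens_mono[of n "Suc n"] by auto
  show "inj_on etop (insert (a, b) F)"
    using inj new e(2) by (auto simp: inj_on_insert)
  fix t m assume tm: "(t, m) \<in> insert (a, b) F \<and> m < t"
  have "m \<notin> etop ` F" using tm e(3) down by auto
  moreover have "m \<noteq> Suc n"
    using tm Fg e(1) by (auto simp: gens_def)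
  ultimately show "m \<notin> etop ` insert (a, b) F" using e(2) by simp
qed

lemma inc_forest_insert_up:
  assumes "inc_forest n F" "a \<in> {1..n}"
  shows "inc_forest (Suc n) (insert (a, Suc n) F)"
  using assms by (intro inc_forest_insert) (auto simp: gens_def etop_def)

lemma inc_forest_insert_down:
  assumes "inc_forest n F" "m \<in> {1..n}" "m \<notin> etop ` F"
  shows "inc_forest (Suc n) (insert (Suc n, m) F)"
  using assms by (intro inc_forest_insert) (simp_all add: gens_def etop_def)

lemma inc_forest_Int: "inc_forest n F \<Longrightarrow> inc_forest m (F \<inter> gens m)"
  unfolding inc_forest_def by (auto intro: inj_on_subset)

text \<open>All edges outside \<open>gens n\<close> have the top \<open>Suc n\<close>, and
  injectivity of \<open>etop\<close> leaves at most one of them.\<close>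

lemma inc_forest_Suc_cases:
  assumes F: "inc_forest (Suc n) F"
  obtains "F = F \<inter> gens n"
  | a where "a \<in> {1..n}" "F = insert (a, Suc n) (F \<inter> gens n)"
  | m where "m \<in> {1..n}" "m \<notin> etop ` (F \<inter> gens n)" "F = insert (Suc n, m) (F \<inter> gens n)"
proof (cases "F \<subseteq> gens n")
  case True
  then show thesis using that(1) by blast
next
  case False
  have Fg: "F \<subseteq> gens (Suc n)" and inj: "inj_on etop F"
    using F by (auto simp: inc_forest_def)
  obtain a b where ab: "(a, b) \<in> F" "(a, b) \<notin> gens n" using False by auto
  then have g: "(a, b) \<in> gens (Suc n)" using Fg by blast
  have top: "etop e = Suc n" if "e \<in> F" "e \<notin> gens n" for e
    using that Fg by (cases e) (auto simp: gens_def etop_def)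
  have "F \<subseteq> insert (a, b) (F \<inter> gens n)"
  proof
    fix e assume e: "e \<in> F"
    show "e \<in> insert (a, b) (F \<inter> gens n)"
    proof (cases "e \<in> gens n")
      case False
      then have "e = (a, b)" using inj_onD[OF inj _ e ab(1)] top e ab by simp
      then show ?thesis by simp
    qed (use e in simp)
  qed
  then have F_eq: "F = insert (a, b) (F \<inter> gens n)" using ab by blast
  from ab g consider "b = Suc n" "a \<in> {1..n}" | "a = Suc n" "b \<in> {1..n}"
    by (auto simp: gens_def)
  then show thesis
  proof cases
    case 1
    then show ?thesis using that(2)[of a] F_eq by simp
  next
    case 2
    then have "b < a" by simp
    then have "b \<notin> etop ` F" using F ab(1) unfolding inc_forest_def by blast
    then have "b \<notin> etop ` (F \<inter> gens n)" by blast
    then show ?thesis using that(3)[of b] F_eq 2 by simp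
  qed
qed

section \<open>Spanning\<close>

text \<open>With these rules the simplifier eta-expands \<open>f + g\<close> and \<open>0\<close> even where they are not applied.\<close>

declare plus_fun_apply [simp del] zero_fun_apply [simp del]

lemma pvb_ideal_add: "a \<in> pvb_ideal n \<Longrightarrow> b \<in> pvb_ideal n \<Longrightarrow> a + b \<in> pvb_ideal n"
  using pvb_ideal.add[of a n b] by (simp only: ext_add_eq)

lemma pvb_ideal_zero: "0 \<in> pvb_ideal n"
  using pvb_ideal.zero[of n] by (simp only: zero_ext_eq)

definition spanned :: "nat \<Rightarrow> ext set" where
  "spanned n = {x. \<exists>c. x - (\<Sum>D\<in>up_down_forests n. scale (c D) (ext_mono D)) \<in> pvb_ideal n}"

section \<open>Linear combinations of forest monomials modulo the ideal\<close>

lemma scale_add_left: "scale (a + b) x = scale a x + scale b x"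
  by (simp add: scale_def fun_eq_iff plus_fun_apply zero_fun_apply distrib_right)

lemma scale_add_right: "scale a (x + y) = scale a x + scale a y"
  by (simp add: scale_def fun_eq_iff plus_fun_apply zero_fun_apply distrib_left)

lemma scale_diff_right: "scale a (x - y) = scale a x - scale a y"
  by (simp add: scale_def fun_eq_iff plus_fun_apply zero_fun_apply right_diff_distrib)

lemma scale_scale: "scale a (scale b x) = scale (a * b) x"
  by (simp add: scale_def fun_eq_iff plus_fun_apply zero_fun_apply)

lemma scale_one [simp]: "scale 1 x = x"
  by (simp add: scale_def)

lemma scale_zero [simp]: "scale 0 x = 0" "scale a 0 = 0"
  by (simp_all add: scale_def fun_eq_iff zero_fun_apply)

lemma scale_sum: "scale a (\<Sum>i\<in>I. f i) = (\<Sum>i\<in>I. scale a (f i))"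
  by (simp add: scale_def fun_eq_iff plus_fun_apply zero_fun_apply sum_apply sum_distrib_left)

lemma spanned_add:
  assumes "x \<in> spanned n" "y \<in> spanned n"
  shows "x + y \<in> spanned n"
proof -
  let ?S = "\<lambda>c. \<Sum>D\<in>up_down_forests n. scale (c D) (ext_mono D)"
  obtain c d where "x - ?S c \<in> pvb_ideal n" "y - ?S d \<in> pvb_ideal n"
    using assms unfolding spanned_def by blast
  then have "(x - ?S c) + (y - ?S d) \<in> pvb_ideal n" by (rule pvb_ideal_add)
  moreover have "(x - ?S c) + (y - ?S d) = (x + y) - ?S (\<lambda>D. c D + d D)"
    by (simp add: scale_add_left sum.distrib algebra_simps)
  ultimately have "(x + y) - ?S (\<lambda>D. c D + d D) \<in> pvb_ideal n" by (simp only:)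
  then show ?thesis unfolding spanned_def by (intro CollectI exI)
qed

lemma spanned_scale:
  assumes "x \<in> spanned n"
  shows "scale a x \<in> spanned n"
proof -
  let ?S = "\<lambda>c. \<Sum>D\<in>up_down_forests n. scale (c D) (ext_mono D)"
  obtain c where "x - ?S c \<in> pvb_ideal n"
    using assms unfolding spanned_def by blast
  then have "scale a (x - ?S c) \<in> pvb_ideal n" by (rule pvb_ideal_scale)
  moreover have "scale a (x - ?S c) = scale a x - ?S (\<lambda>D. a * c D)"
    by (simp add: scale_diff_right scale_sum scale_scale)
  ultimately have "scale a x - ?S (\<lambda>D. a * c D) \<in> pvb_ideal n" by (simp only:)
  then show ?thesis unfolding spanned_def by (intro CollectI exI)
qed

lemma spanned_diff: "x \<in> spanned n \<Longrightarrow> y \<in> spanned n \<Longrightarrow> x - y \<in> spanned n"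
  using spanned_add[of x n "scale (-1) y"] spanned_scale[of y n "-1"]
  by (simp add: scale_def plus_fun_def fun_diff_def)

lemma pvb_ideal_spanned:
  assumes "x \<in> pvb_ideal n"
  shows "x \<in> spanned n"
proof -
  have "x - (\<Sum>D\<in>up_down_forests n. scale 0 (ext_mono D)) \<in> pvb_ideal n"
    using assms by simp
  then show ?thesis unfolding spanned_def by (intro CollectI exI)
qed

lemma spanned_zero: "0 \<in> spanned n"
  by (simp add: pvb_ideal_spanned pvb_ideal_zero)

lemma spanned_sum: "(\<And>i. i \<in> I \<Longrightarrow> f i \<in> spanned n) \<Longrightarrow> (\<Sum>i\<in>I. f i) \<in> spanned n"
  by (induction I rule: infinite_finite_induct) (auto intro: spanned_zero spanned_add)

lemma inc_forest_spanned:
  assumes "inc_forest n F"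
  shows "ext_mono F \<in> spanned n"
proof -
  have "(\<Sum>D\<in>up_down_forests n. scale (if D = F then 1 else 0) (ext_mono D)) =
      (\<Sum>D\<in>up_down_forests n. if D = F then ext_mono D else 0)"
    by (rule sum.cong) auto
  also have "\<dots> = ext_mono F"
    using assms finite_inc_forests by (simp add: up_down_forests_eq)
  finally have "ext_mono F - (\<Sum>D\<in>up_down_forests n. scale (if D = F then 1 else 0) (ext_mono D)) = 0"
    by simp
  then have "ext_mono F - (\<Sum>D\<in>up_down_forests n. scale (if D = F then 1 else 0) (ext_mono D)) \<in> pvb_ideal n"
    using pvb_ideal_zero by (simp only:)
  then show ?thesis unfolding spanned_def by (intro CollectI exI)
qed

text \<open>Modulo the ideal on \<open>[m]\<close> the factor \<open>x\<close> is a combination of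
  forests, and multiplication by \<open>z\<close> carries that ideal into the one on
  \<open>[n]\<close>. So only products of a single forest with \<open>z\<close> remain to be
  treated.\<close>

lemma spanned_wedge:
  assumes "x \<in> spanned m" "m \<le> n" "z \<in> ExtAlg n"
    and forest: "\<And>D. inc_forest m D \<Longrightarrow> wedge (ext_mono D) z \<in> spanned n"
  shows "wedge x z \<in> spanned n"
proof -
  obtain c where "x - (\<Sum>D\<in>up_down_forests m. scale (c D) (ext_mono D)) \<in> pvb_ideal m"
    (is "x - ?y \<in> _")
    using assms(1) unfolding spanned_def by blast
  then have "wedge (x - ?y) z \<in> spanned n"
    using assms(2,3) by (intro pvb_ideal_spanned pvb_ideal_wedge_right)
  moreover have "wedge (\<Sum>D\<in>A. scale (c D) (ext_mono D)) z = (\<Sum>D\<in>A. scale (c D) (wedge (ext_mono D) z))" for A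
    by (induction A rule: infinite_finite_induct) (simp_all add: wedge_add_left wedge_scale_left)
  then have "wedge ?y z \<in> spanned n"
    using forest by (auto simp: up_down_forests_eq intro!: spanned_sum spanned_scale)
  ultimately have "wedge (x - ?y) z + wedge ?y z \<in> spanned n" by (rule spanned_add)
  then show ?thesis by (simp add: wedge_diff_left)
qed

text \<open>The two edges to be rewritten are kept apart from the rest \<open>A\<close> of the
  monomial, so that a relation applies literally and no signs have to be followed.\<close>

definition quad :: "edge set \<Rightarrow> edge \<Rightarrow> edge \<Rightarrow> ext" where
  "quad A e f = wedge (ext_mono A) (wedge (ext_mono {e}) (ext_mono {f}))"

text \<open>The product is 0 if an edge repeats, and otherwise the monomial of the union up to a
  sign, which can be undone because its square is 1.\<close>

lemma quad_spanned_iff: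
  assumes "finite A"
  shows "quad A e f \<in> spanned n \<longleftrightarrow>
    (e \<noteq> f \<and> e \<notin> A \<and> f \<notin> A \<longrightarrow> ext_mono (insert e (insert f A)) \<in> spanned n)"
proof (cases "e \<noteq> f \<and> e \<notin> A \<and> f \<notin> A")
  case True
  define s where "s = ex_sign {e} {f} * ex_sign A {e, f}"
  have ss: "s * s = 1"
    using ex_sign_cases[of "{e}" "{f}"] ex_sign_cases[of A "{e, f}"] by (auto simp: s_def)
  have q: "quad A e f = scale s (ext_mono (insert e (insert f A)))"
    using True assms by (simp add: quad_def wedge_mono wedge_scale_right scale_scale s_def insert_commute)
  have "ext_mono (insert e (insert f A)) = scale s (quad A e f)"
    by (simp add: q scale_scale ss)
  then show ?thesis using q spanned_scale True by metis
next
  case False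
  then have "quad A e f = 0"
    using assms by (auto simp: quad_def wedge_mono wedge_scale_right)
  then show ?thesis using False spanned_zero by auto
qed

lemma quad_commute: "finite A \<Longrightarrow> quad A e f \<in> spanned n \<longleftrightarrow> quad A f e \<in> spanned n"
  by (auto simp: quad_spanned_iff insert_commute)

section \<open>The relations inside a longer monomial\<close>

lemma wedge_r_one: "wedge (r i j) (ext_mono {}) = r i j"
  by (simp add: r_def wedge_mono)

lemma rel_wedge_in_ideal:
  assumes "\<rho> \<in> pvb_rels n" "A \<subseteq> gens n"
  shows "wedge (ext_mono A) \<rho> \<in> pvb_ideal n"
proof -
  \<comment> \<open>The generators of the ideal have cofactors on both sides; the unit
    \<open>ext_mono {}\<close> serves as the right one.\<close>
  have "wedge \<rho> (ext_mono {}) = \<rho>"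
    using assms(1) unfolding pvb_rels_def
    by (auto simp: ext_add_eq ext_diff_eq wedge_add_left wedge_diff_left wedge_assoc wedge_r_one)
  moreover have "wedge (wedge (ext_mono A) \<rho>) (ext_mono {}) \<in> pvb_ideal n"
    using assms by (intro pvb_ideal.gen ext_mono_in) auto
  ultimately show ?thesis by (simp add: wedge_assoc)
qed

lemma rel_out:
  assumes "A \<subseteq> gens n" "i \<in> {1..n}" "j \<in> {1..n}" "k \<in> {1..n}" "i \<noteq> j" "i \<noteq> k" "j \<noteq> k"
  shows "quad A (i,j) (i,k) - quad A (i,j) (j,k) + quad A (i,k) (k,j) \<in> pvb_ideal n"
proof -
  have "ext_add (ext_diff (wedge (r i j) (r i k)) (wedge (r i j) (r j k))) (wedge (r i k) (r k j)) \<in> pvb_rels n"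
    unfolding pvb_rels_def using assms(2-) by blast
  from rel_wedge_in_ideal[OF this assms(1)] show ?thesis
    unfolding ext_add_eq ext_diff_eq wedge_add_right wedge_diff_right r_def quad_def .
qed

lemma rel_in:
  assumes "A \<subseteq> gens n" "i \<in> {1..n}" "j \<in> {1..n}" "k \<in> {1..n}" "i \<noteq> j" "i \<noteq> k" "j \<noteq> k"
  shows "quad A (i,k) (j,k) - quad A (i,j) (j,k) + quad A (j,i) (i,k) \<in> pvb_ideal n"
proof -
  have "ext_add (ext_diff (wedge (r i k) (r j k)) (wedge (r i j) (r j k))) (wedge (r j i) (r i k)) \<in> pvb_rels n"
    unfolding pvb_rels_def using assms(2-) by blast
  from rel_wedge_in_ideal[OF this assms(1)] show ?thesis
    unfolding ext_add_eq ext_diff_eq wedge_add_right wedge_diff_right r_def quad_def .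
qed

lemma rel_opposite:
  assumes "A \<subseteq> gens n" "i \<in> {1..n}" "j \<in> {1..n}" "i \<noteq> j"
  shows "quad A (i,j) (j,i) \<in> pvb_ideal n"
proof -
  have "wedge (r i j) (r j i) \<in> pvb_rels n"
    unfolding pvb_rels_def using assms(2-) by blast
  from rel_wedge_in_ideal[OF this assms(1)] show ?thesis
    unfolding r_def quad_def .
qed

lemma spanned_rel_first:
  assumes "x - y + z \<in> pvb_ideal n" "y \<in> spanned n" "z \<in> spanned n"
  shows "x \<in> spanned n"
proof -
  have "((x - y + z) + y) - z \<in> spanned n"
    using spanned_add spanned_diff pvb_ideal_spanned[OF assms(1)] assms(2,3) by presburger
  then show ?thesis by (simp add: algebra_simps)
qed

lemma spanned_rel_second:
  assumes "x - y + z \<in> pvb_ideal n" "x \<in> spanned n" "z \<in> spanned n"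
  shows "y \<in> spanned n"
proof -
  have "x + z - (x - y + z) \<in> spanned n"
    using spanned_add spanned_diff pvb_ideal_spanned[OF assms(1)] assms(2,3) by presburger
  then show ?thesis by (simp add: algebra_simps)
qed

lemma spanned_rel_third:
  assumes "x - y + z \<in> pvb_ideal n" "x \<in> spanned n" "y \<in> spanned n"
  shows "z \<in> spanned n"
proof -
  have "((x - y + z) + y) - x \<in> spanned n"
    using spanned_add spanned_diff pvb_ideal_spanned[OF assms(1)] assms(2,3) by presburger
  then show ?thesis by (simp add: algebra_simps)
qed

text \<open>Modulo the relations and up to edges \<open>(a, Suc n)\<close>, the edge \<open>(Suc n, k)\<close> may slide along any
  edge of \<open>F\<close> at \<open>k\<close>; it is slid towards the root.\<close>

lemma insert_down_spanned:
  assumes F: "inc_forest n F" and k: "k \<in> {1..n}"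
  shows "ext_mono (insert (Suc n, k) F) \<in> spanned (Suc n)"
  using k
proof (induction k rule: less_induct)
  case (less k)
  show ?case
  proof (cases "k \<in> etop ` F")
    case False
    then show ?thesis
      using F less.prems by (intro inc_forest_spanned inc_forest_insert_down)
  next
    case True
    then obtain e where e: "e \<in> F" "etop e = k" by blast
    define A where "A = F - {e}"
    have Fg: "F \<subseteq> gens n" using F by (simp add: inc_forest_def)
    have A: "A \<subseteq> gens (Suc n)" "finite A"
      using Fg gens_mono[of n "Suc n"] inc_forest_finite[OF F] by (auto simp: A_def)
    have F_eq: "F = insert e A" using e by (auto simp: A_def)
    have up: "ext_mono (insert (a, Suc n) F) \<in> spanned (Suc n)" if "a \<in> {1..n}" for a
      using F that by (intro inc_forest_spanned inc_forest_insert_up)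
    have qup: "quad A e (a, Suc n) \<in> spanned (Suc n)" if "a \<in> {1..n}" for a
      using up[OF that] A by (simp add: quad_spanned_iff F_eq insert_commute)
    obtain a b where ab: "e = (a, b)" by (cases e)
    then have "(a, b) \<in> gens n" using e Fg by blast
    then have g: "a \<in> {1..n}" "b \<in> {1..n}" "a < b \<or> b < a" by (auto simp: gens_def)
    have "max a b = k" using e ab by (simp add: etop_def)
    then have "b = k \<or> a = k" "a < b \<Longrightarrow> b = k" "b < a \<Longrightarrow> a = k" by linarith+
    then consider j where "e = (j, k)" "j < k" "j \<in> {1..n}" | j where "e = (k, j)" "j < k" "j \<in> {1..n}"
      using g ab by blast
    then have "quad A (Suc n, k) e \<in> spanned (Suc n)"
    proof cases
      case 1
      \<comment> \<open>The relation with two edges into \<open>k\<close> exchanges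
        \<open>(Suc n, k)\<close> for \<open>(Suc n, j)\<close>, up to a term with the path from
        \<open>j\<close> over \<open>Suc n\<close> to \<open>k\<close>. The relation with two edges
        out of \<open>j\<close> turns that path into products of \<open>e\<close> with an edge into
        \<open>Suc n\<close>.\<close>
      have "quad A (Suc n, j) e \<in> spanned (Suc n)"
        using less.IH[OF 1(2,3)] A by (simp add: quad_spanned_iff F_eq)
      moreover have "quad A (j, Suc n) (Suc n, k) \<in> spanned (Suc n)"
        using 1 less.prems qup[of j] qup[of k]
        by (intro spanned_rel_third[OF rel_out[OF A(1), of j k "Suc n"]]) simp_all
      ultimately show ?thesis
        using 1 less.prems unfolding 1(1)
        by (intro spanned_rel_first[OF rel_in[OF A(1), of "Suc n" j k]]) simp_all
    next
      case 2
      \<comment> \<open>Here the edge points from \<open>k\<close> to \<open>j\<close>: the two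
        edges into \<open>j\<close> are traded for the path from \<open>Suc n\<close> over
        \<open>k\<close> to \<open>j\<close>, and the error term is the path from \<open>k\<close>
        over \<open>Suc n\<close> to \<open>j\<close>.\<close>
      have "quad A (Suc n, j) e \<in> spanned (Suc n)"
        using less.IH[OF 2(2,3)] A by (simp add: quad_spanned_iff F_eq)
      moreover have "quad A (k, Suc n) (Suc n, j) \<in> spanned (Suc n)"
        using 2 less.prems qup[of j] qup[of k]
        by (intro spanned_rel_third[OF rel_out[OF A(1), of k j "Suc n"]]) simp_all
      ultimately show ?thesis
        using 2 less.prems unfolding 2(1)
        by (intro spanned_rel_second[OF rel_in[OF A(1), of "Suc n" k j]]) simp_all
    qed
    moreover have "(Suc n, k) \<notin> F" using Fg by (auto simp: gens_def)
    moreover have "(Suc n, k) \<noteq> e" "e \<notin> A" "(Suc n, k) \<notin> A"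
      using calculation(2) e by (auto simp: A_def)
    ultimately show ?thesis
      unfolding F_eq by (simp add: quad_spanned_iff[OF A(2)])
  qed
qed

text \<open>Outer induction on the number of vertices, inner induction on the number of edges at the
  largest one. With at most one such edge, the rest is a combination of smaller forests by the outer
  hypothesis; two such edges are rewritten by the relations into terms with fewer of them.\<close>

lemma mono_spanned: "A \<subseteq> gens n \<Longrightarrow> ext_mono A \<in> spanned n"
proof (induction n arbitrary: A)
  case 0
  then have "inc_forest 0 A" by (auto simp: inc_forest_def gens_def)
  then show ?case by (rule inc_forest_spanned)
next
  case (Suc n)
  let ?N = "Suc n"
  have old: "ext_mono A \<in> spanned ?N" if A: "A \<subseteq> gens n" for A
  proof -
    have one: "wedge (ext_mono B) (ext_mono {}) = ext_mono B" if "finite B" for B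
      using that by (simp add: wedge_mono)
    \<comment> \<open>Multiplication by the unit lets \<open>spanned_wedge\<close> carry the
      hypothesis from \<open>n\<close> to \<open>Suc n\<close> vertices.\<close>
    have "wedge (ext_mono A) (ext_mono {}) \<in> spanned ?N"
    proof (rule spanned_wedge[OF Suc.IH[OF A]])
      fix D assume D: "inc_forest n D"
      show "wedge (ext_mono D) (ext_mono {}) \<in> spanned ?N"
        using inc_forest_spanned[OF inc_forest_Suc[OF D]] one inc_forest_finite[OF D] by simp
    qed (auto intro: ext_mono_in)
    then show ?thesis using one A finite_gens finite_subset by metis
  qed
  have single: "ext_mono (insert e A) \<in> spanned ?N" if A: "A \<subseteq> gens n" and e: "e \<in> gens ?N" "e \<notin> gens n" for A e
  proof -
    have one: "wedge (ext_mono B) (ext_mono {e}) = scale (ex_sign B {e}) (ext_mono (insert e B))"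
      if "B \<subseteq> gens n" for B
    proof -
      have "finite B" using that finite_gens finite_subset by blast
      then show ?thesis using that e by (auto simp: wedge_mono)
    qed
    have forest: "ext_mono (insert e D) \<in> spanned ?N" if D: "inc_forest n D" for D
    proof -
      from e consider a where "a \<in> {1..n}" "e = (a, ?N)" | k where "k \<in> {1..n}" "e = (?N, k)"
        by (cases e) (auto simp: gens_def)
      then show ?thesis
      proof cases
        case 1
        then show ?thesis using inc_forest_spanned[OF inc_forest_insert_up[OF D]] by simp
      next
        case 2
        then show ?thesis using insert_down_spanned[OF D] by simp
      qed
    qed
    have "wedge (ext_mono A) (ext_mono {e}) \<in> spanned ?N"
    proof (rule spanned_wedge[OF Suc.IH[OF A]])
      fix D assume D: "inc_forest n D"
      then have "D \<subseteq> gens n" by (simp add: inc_forest_def)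
      then show "wedge (ext_mono D) (ext_mono {e}) \<in> spanned ?N"
        using spanned_scale[OF forest[OF D]] by (simp add: one)
    qed (use e in \<open>auto intro: ext_mono_in\<close>)
    then have "scale (ex_sign A {e}) (wedge (ext_mono A) (ext_mono {e})) \<in> spanned ?N"
      by (rule spanned_scale)
    then show ?thesis
      using ex_sign_cases[of A "{e}"] by (auto simp: one[OF A] scale_scale)
  qed
  show ?case using Suc.prems
  proof (induction "card (A - gens n)" arbitrary: A rule: less_induct)
    case less
    have finA: "finite A" using less.prems finite_gens finite_subset by blast
    consider "A \<subseteq> gens n" | e where "e \<in> A" "e \<notin> gens n" "A - {e} \<subseteq> gens n"
      | e f where "e \<in> A" "e \<notin> gens n" "f \<in> A" "f \<notin> gens n" "e \<noteq> f"
      by blast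
    then show ?case
    proof cases
      case 1
      then show ?thesis by (rule old)
    next
      case 2
      then show ?thesis using single[of "A - {e}" e] less.prems by (auto simp: insert_absorb)
    next
      case (3 e f)
      define B where "B = A - {e, f}"
      have B: "B \<subseteq> gens ?N" "finite B" using less.prems finA by (auto simp: B_def)
      have A_eq: "A = insert e (insert f B)" using 3 by (auto simp: B_def)
      have ef: "e \<noteq> f" by (rule 3)
      have AB: "A - gens n = insert e (insert f (B - gens n))"
        using 3 by (auto simp: B_def)
      have "e \<notin> B" "f \<notin> B" by (auto simp: B_def)
      then have cardA: "card (A - gens n) = Suc (Suc (card (B - gens n)))"
        using 3 B unfolding AB by simp
      \<comment> \<open>One of the two edges now avoids \<open>Suc n\<close>, so at most one edge at
        that vertex is added to those of \<open>B\<close>, where \<open>A\<close> has two; the inner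
        hypothesis applies.\<close>
      have simpler: "quad B (i, j) h \<in> spanned ?N"
        if ij: "i \<in> {1..n}" "j \<in> {1..n}" "i \<noteq> j" and h: "h \<in> gens ?N" for i j h
      proof -
        let ?A = "insert (i, j) (insert h B)"
        have g: "(i, j) \<in> gens n" using ij by (simp add: gens_def)
        have "?A - gens n \<subseteq> insert h (B - gens n)" using g by auto
        then have "card (?A - gens n) \<le> card (insert h (B - gens n))"
          using B by (intro card_mono) auto
        also have "\<dots> < card (A - gens n)"
          using B by (simp add: cardA card_insert_if)
        finally have "card (?A - gens n) < card (A - gens n)" .
        moreover have "?A \<subseteq> gens ?N"
          using g h B gens_mono[of n ?N] by auto
        ultimately show ?thesis
          using less.hyps B by (simp add: quad_spanned_iff)
      qed
      have nedge: "(i, ?N) \<in> gens ?N" "(?N, i) \<in> gens ?N" if "i \<in> {1..n}" for i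
        using that by (auto simp: gens_def)
      have new: "(\<exists>i\<in>{1..n}. x = (i, ?N)) \<or> (\<exists>i\<in>{1..n}. x = (?N, i))"
        if "x \<in> A" "x \<notin> gens n" for x
        using that less.prems by (cases x) (auto simp: gens_def)
      \<comment> \<open>A path from \<open>i\<close> over \<open>Suc n\<close> to \<open>j\<close>
        occurs in the relation for two edges out of \<open>i\<close>, whose other terms contain
        \<open>(i, j)\<close>; for \<open>i = j\<close> the product of opposite edges is itself a
        relation.\<close>
      have mixed: "quad B (i, ?N) (?N, j) \<in> spanned ?N"
        if ij: "i \<in> {1..n}" "j \<in> {1..n}" for i j
      proof (cases "i = j")
        case True
        then show ?thesis
          using rel_opposite[OF B(1), of i ?N] ij by (auto intro: pvb_ideal_spanned)
      next
        case False
        then show ?thesis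
          using simpler[of i j "(i, ?N)"] simpler[of i j "(j, ?N)"] nedge ij
          by (intro spanned_rel_third[OF rel_out[OF B(1), of i j ?N]]) simp_all
      qed
      have "quad B e f \<in> spanned ?N"
      proof -
        \<comment> \<open>Two edges into \<open>Suc n\<close> and two edges out of it are the
          leading terms of the two cubic-index relations; opposite directions are
          \<open>mixed\<close>.\<close>
        consider i j where "i \<in> {1..n}" "j \<in> {1..n}" "e = (i, ?N)" "f = (j, ?N)"
          | i j where "i \<in> {1..n}" "j \<in> {1..n}" "e = (i, ?N)" "f = (?N, j)"
          | i j where "i \<in> {1..n}" "j \<in> {1..n}" "e = (?N, i)" "f = (j, ?N)"
          | i j where "i \<in> {1..n}" "j \<in> {1..n}" "e = (?N, i)" "f = (?N, j)"
          using new[of e] new[of f] 3 by blast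
        then show ?thesis
        proof cases
          case (1 i j)
          then show ?thesis
            using simpler[of i j "(j, ?N)"] simpler[of j i "(i, ?N)"] nedge ef
            unfolding 1(3,4) by (intro spanned_rel_first[OF rel_in[OF B(1), of i j ?N]]) simp_all
        next
          case (2 i j)
          then show ?thesis using mixed by simp
        next
          case (3 i j)
          then show ?thesis using mixed quad_commute[OF B(2)] by simp
        next
          case (4 i j)
          then have ij: "i \<noteq> j" using ef by simp
          then have "quad B (?N, i) (i, j) \<in> spanned ?N" "quad B (?N, j) (j, i) \<in> spanned ?N"
            using simpler[of i j "(?N, i)"] simpler[of j i "(?N, j)"] nedge 4
            by (simp_all add: quad_commute[OF B(2), of "(?N, _)"])
          then show ?thesis
            using 4 ij unfolding 4(3,4) by (intro spanned_rel_first[OF rel_out[OF B(1), of ?N i j]]) simp_all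
        qed
      qed
      then show ?thesis
        unfolding A_eq using ef \<open>e \<notin> B\<close> \<open>f \<notin> B\<close> by (simp add: quad_spanned_iff[OF B(2)])
    qed
  qed
qed

lemma ExtAlg_spanned: "x \<in> ExtAlg n \<Longrightarrow> x \<in> spanned n"
  by (subst ext_expand) (auto intro!: spanned_sum spanned_scale mono_spanned)

section \<open>Chain orders isolating a forest\<close>

text \<open>A disjoint union of chains: the last two clauses make comparability transitive, so the
  points comparable to a given one are linearly ordered.\<close>

definition chain_order :: "edge set \<Rightarrow> bool" where
  "chain_order L \<longleftrightarrow> trans L \<and> irrefl L \<and>
     (\<forall>i j k. (i, j) \<in> L \<longrightarrow> (i, k) \<in> L \<longrightarrow> j = k \<or> (j, k) \<in> L \<or> (k, j) \<in> L) \<and>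
     (\<forall>i j k. (i, k) \<in> L \<longrightarrow> (j, k) \<in> L \<longrightarrow> i = j \<or> (i, j) \<in> L \<or> (j, i) \<in> L)"

lemma chain_order_trans: "chain_order L \<Longrightarrow> (i, j) \<in> L \<Longrightarrow> (j, k) \<in> L \<Longrightarrow> (i, k) \<in> L"
  unfolding chain_order_def by (meson transD)

lemma chain_order_irrefl: "chain_order L \<Longrightarrow> (i, i) \<notin> L"
  unfolding chain_order_def by (meson irreflD)

lemma chain_order_out:
  "chain_order L \<Longrightarrow> (i, j) \<in> L \<Longrightarrow> (i, k) \<in> L \<Longrightarrow> j = k \<or> (j, k) \<in> L \<or> (k, j) \<in> L"
  unfolding chain_order_def by meson

lemma chain_order_in:
  "chain_order L \<Longrightarrow> (i, k) \<in> L \<Longrightarrow> (j, k) \<in> L \<Longrightarrow> i = j \<or> (i, j) \<in> L \<or> (j, i) \<in> L"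
  unfolding chain_order_def by meson

text \<open>The new point goes in front of the whole chain of \<open>u\<close>. This chain is closed
  under going up (\<open>up\<close>) and down (\<open>dn\<close>) and is linear
  (\<open>lin\<close>).\<close>

lemma chain_order_insert_first:
  assumes L: "chain_order L" "L \<subseteq> V \<times> V" and N: "N \<notin> V" and u: "u \<in> V"
  shows "chain_order (L \<union> {N} \<times> {x. x = u \<or> (x, u) \<in> L \<or> (u, x) \<in> L})"
proof -
  let ?C = "{x. x = u \<or> (x, u) \<in> L \<or> (u, x) \<in> L}"
  have NL: "(N, x) \<notin> L" "(x, N) \<notin> L" for x using L(2) N by auto
  have NC: "N \<notin> ?C" using NL N u by auto
  note tr = chain_order_trans[OF L(1)] and ir = chain_order_irrefl[OF L(1)]
    and ou = chain_order_out[OF L(1)] and inn = chain_order_in[OF L(1)]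
  have up: "y \<in> ?C" if "x \<in> ?C" "(x, y) \<in> L" for x y
    using that tr[of u x y] ou[of x y u] by auto
  have dn: "x \<in> ?C" if "y \<in> ?C" "(x, y) \<in> L" for x y
    using that tr[of x y u] inn[of x y u] by auto
  have lin: "x = y \<or> (x, y) \<in> L \<or> (y, x) \<in> L" if "x \<in> ?C" "y \<in> ?C" for x y
    using that tr[of x u y] tr[of y u x] inn[of x u y] ou[of u x y] by auto
  let ?L = "L \<union> {N} \<times> ?C"
  have iff: "(x, y) \<in> ?L \<longleftrightarrow> (x, y) \<in> L \<or> x = N \<and> y \<in> ?C" for x y by blast
  show ?thesis
    unfolding chain_order_def
  proof (intro conjI allI impI)
    show "trans ?L"
    proof (rule transI)
      fix x y z assume "(x, y) \<in> ?L" "(y, z) \<in> ?L"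
      then show "(x, z) \<in> ?L" unfolding iff using tr[of x y z] up[of y z] NL NC by blast
    qed
    show "irrefl ?L" by (rule irreflI) (use ir NC in blast)
    fix i j k
    show "j = k \<or> (j, k) \<in> ?L \<or> (k, j) \<in> ?L" if "(i, j) \<in> ?L" "(i, k) \<in> ?L"
      using that unfolding iff using ou[of i j k] lin[of j k] NL by blast
    show "i = j \<or> (i, j) \<in> ?L \<or> (j, i) \<in> ?L" if "(i, k) \<in> ?L" "(j, k) \<in> ?L"
      using that unfolding iff using inn[of i k j] dn[of k i] dn[of k j] NL by blast
  qed
qed

text \<open>The new point is inserted immediately behind \<open>a\<close> in the chain of
  \<open>a\<close>.\<close>

lemma chain_order_insert_after:
  assumes L: "chain_order L" "L \<subseteq> V \<times> V" and N: "N \<notin> V" and a: "a \<in> V"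
  shows "chain_order (L \<union> {x. x = a \<or> (x, a) \<in> L} \<times> {N} \<union> {N} \<times> {y. (a, y) \<in> L})"
proof -
  have NL: "(N, x) \<notin> L" "(x, N) \<notin> L" for x using L(2) N by auto
  have Na: "N \<noteq> a" using N a by blast
  note tr = chain_order_trans[OF L(1)] and ir = chain_order_irrefl[OF L(1)]
    and ou = chain_order_out[OF L(1)] and inn = chain_order_in[OF L(1)]
  let ?L = "L \<union> {x. x = a \<or> (x, a) \<in> L} \<times> {N} \<union> {N} \<times> {y. (a, y) \<in> L}"
  have iff: "(x, y) \<in> ?L \<longleftrightarrow> (x, y) \<in> L \<or> y = N \<and> (x = a \<or> (x, a) \<in> L) \<or> x = N \<and> (a, y) \<in> L"
    for x y by blast
  show ?thesis
    unfolding chain_order_def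
  proof (intro conjI allI impI)
    show "trans ?L"
    proof (rule transI)
      fix x y z assume "(x, y) \<in> ?L" "(y, z) \<in> ?L"
      then show "(x, z) \<in> ?L"
        unfolding iff using tr[of x y z] tr[of x y a] tr[of a y z] tr[of x a z] tr[of a y a] ir[of a] NL Na by blast
    qed
    show "irrefl ?L" by (rule irreflI) (use ir NL Na in blast)
    fix i j k
    show "j = k \<or> (j, k) \<in> ?L \<or> (k, j) \<in> ?L" if "(i, j) \<in> ?L" "(i, k) \<in> ?L"
      using that unfolding iff
      using ou[of i j k] ou[of a j k] ou[of i j a] ou[of i k a] NL Na by blast
    show "i = j \<or> (i, j) \<in> ?L \<or> (j, i) \<in> ?L" if "(i, k) \<in> ?L" "(j, k) \<in> ?L"
      using that unfolding iff
      using inn[of i k j] inn[of i a j] inn[of i k a] inn[of j k a] NL Na by blast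
  qed
qed

text \<open>The clause on pairs in \<open>L\<close> says that a chain contains at most one component
  minimum of \<open>F\<close>; it carries the induction in \<open>ex_isolates\<close>. By the last
  clause any other member of the family leaves \<open>L\<close> or has lower degree.\<close>

definition isolates :: "nat \<Rightarrow> edge set \<Rightarrow> edge set \<Rightarrow> edge set set \<Rightarrow> bool" where
  "isolates n L F \<F> \<longleftrightarrow> chain_order L \<and> L \<subseteq> {1..n} \<times> {1..n} \<and> F \<in> \<F> \<and> F \<subseteq> L \<and>
     (\<forall>a b. (a, b) \<in> L \<longrightarrow> a \<in> etop ` F \<or> b \<in> etop ` F) \<and>
     (\<forall>F'\<in>\<F>. F' \<subseteq> L \<longrightarrow> F' \<noteq> F \<longrightarrow> card F' < card F)"

lemma card_inc_forest_Suc: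
  assumes "inc_forest (Suc n) F"
  shows "card F \<le> Suc (card (F \<inter> gens n))"
  using assms
proof (cases rule: inc_forest_Suc_cases)
  case 1
  then show ?thesis by simp
next
  case (2 a)
  then show ?thesis by (metis card_insert_le_m1 card_insert_if finite_Int finite_gens le_Suc_eq order_refl)
next
  case (3 m)
  then show ?thesis by (metis card_insert_if finite_Int finite_gens le_Suc_eq order_refl)
qed

text \<open>A competitor whose restriction to \<open>[n]\<close> differs from \<open>F0\<close> is
  behind by at least one edge there and regains at most one at \<open>Suc n\<close>. A competitor
  with restriction \<open>F0\<close> either lacks an edge at \<open>Suc n\<close> or has one, which
  \<open>up\<close> and \<open>dn\<close> force to be \<open>e\<close>.\<close>

lemma isolates_insert:
  assumes L0: "isolates n L0 F0 ((\<lambda>F. F \<inter> gens n) ` \<F>)"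
    and \<F>: "\<And>F. F \<in> \<F> \<Longrightarrow> inc_forest (Suc n) F"
    and L: "chain_order L" "L \<subseteq> {1..Suc n} \<times> {1..Suc n}" "L0 \<subseteq> L"
    and Lold: "\<And>x y. (x, y) \<in> L \<Longrightarrow> x \<noteq> Suc n \<Longrightarrow> y \<noteq> Suc n \<Longrightarrow> (x, y) \<in> L0"
    and e: "insert e F0 \<in> \<F>" "e \<in> L" "e \<notin> gens n"
    and up: "\<And>a. (a, Suc n) \<in> L \<Longrightarrow> insert (a, Suc n) F0 \<in> \<F> \<Longrightarrow> a \<in> {1..n} \<Longrightarrow> e = (a, Suc n)"
    and dn: "\<And>m. (Suc n, m) \<in> L \<Longrightarrow> insert (Suc n, m) F0 \<in> \<F> \<Longrightarrow> m \<in> {1..n} \<Longrightarrow>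
      m \<notin> etop ` F0 \<Longrightarrow> e = (Suc n, m)"
  shows "isolates (Suc n) L (insert e F0) \<F>"
proof -
  let ?F = "insert e F0"
  obtain G where G: "G \<in> \<F>" "F0 = G \<inter> gens n"
    using L0 by (auto simp: isolates_def)
  have F0: "finite F0" "F0 \<subseteq> gens n" "F0 \<subseteq> L0" using G L0 finite_gens by (auto simp: isolates_def)
  have "e \<notin> F0" using F0(2) e(3) by blast
  then have card: "card ?F = Suc (card F0)" using F0(1) by simp
  have "e \<in> gens (Suc n)" using \<F>[OF e(1)] by (auto simp: inc_forest_def)
  then have "etop e = Suc n" using e(3) by (cases e) (auto simp: gens_def etop_def)
  then have top: "etop ` ?F = insert (Suc n) (etop ` F0)" by simp
  show ?thesis
    unfolding isolates_def
  proof (intro conjI allI impI ballI)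
    show "chain_order L" "L \<subseteq> {1..Suc n} \<times> {1..Suc n}" "?F \<in> \<F>" "?F \<subseteq> L"
      using L e F0 by auto
    show "a \<in> etop ` ?F \<or> b \<in> etop ` ?F" if "(a, b) \<in> L" for a b
      using Lold[OF that] L0 unfolding top isolates_def by blast
    fix F' assume F': "F' \<in> \<F>" "F' \<subseteq> L" "F' \<noteq> ?F"
    have F'L0: "F' \<inter> gens n \<subseteq> L0"
    proof
      fix x assume "x \<in> F' \<inter> gens n"
      then show "x \<in> L0" using F'(2) Lold by (cases x) (auto simp: gens_def)
    qed
    show "card F' < card ?F"
    proof (cases "F' \<inter> gens n = F0")
      case False
      then have "card (F' \<inter> gens n) < card F0"
        using L0 F'L0 F'(1) unfolding isolates_def by blast
      then show ?thesis using card_inc_forest_Suc[OF \<F>[OF F'(1)]] card by linarith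
    next
      case True
      from \<F>[OF F'(1)] show ?thesis
      proof (cases rule: inc_forest_Suc_cases)
        case 1
        then show ?thesis using True card by simp
      next
        case (2 a)
        then show ?thesis using True F' up[of a] by auto
      next
        case (3 m)
        then show ?thesis using True F' dn[of m] by auto
      qed
    qed
  qed
qed

text \<open>An isolating pair for the restrictions to \<open>[n]\<close> is extended by placing the
  vertex \<open>n + 1\<close> into the order, so that one extension of \<open>F\<close> stays inside
  it and is larger than every other member of the family that does.\<close>

lemma ex_isolates:
  assumes "\<F> \<noteq> {}" "\<And>F. F \<in> \<F> \<Longrightarrow> inc_forest n F"
  shows "\<exists>L F. isolates n L F \<F>"
  using assms
proof (induction n arbitrary: \<F>)
  case 0
  have "F = {}" if "F \<in> \<F>" for F
    using 0(2)[OF that] by (auto simp: inc_forest_def gens_def)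
  then have "\<F> = {{}}" using 0(1) by blast
  then have "isolates 0 {} {} \<F>"
    by (auto simp: isolates_def chain_order_def irrefl_def)
  then show ?case by blast
next
  case (Suc n)
  let ?N = "Suc n"
  have "\<exists>L F. isolates n L F ((\<lambda>F. F \<inter> gens n) ` \<F>)"
    using Suc.prems inc_forest_Int by (intro Suc.IH) blast+
  then obtain L F where LF: "isolates n L F ((\<lambda>F. F \<inter> gens n) ` \<F>)" by blast
  then have L: "chain_order L" "L \<subseteq> {1..n} \<times> {1..n}"
    and root: "\<And>a b. (a, b) \<in> L \<Longrightarrow> a \<in> etop ` F \<or> b \<in> etop ` F"
    by (auto simp: isolates_def)
  have NL: "(?N, x) \<notin> L" "(x, ?N) \<notin> L" for x using L(2) by auto
  have new: "(?N, x) \<notin> gens n" "(x, ?N) \<notin> gens n" for x by (auto simp: gens_def)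
  have N: "?N \<notin> {1..n}" by simp
  obtain G where G: "G \<in> \<F>" "F = G \<inter> gens n"
    using LF by (auto simp: isolates_def)
  consider u where "insert (?N, u) F \<in> \<F>" "u \<in> {1..n}" "u \<notin> etop ` F"
    | a where "insert (a, ?N) F \<in> \<F>" "a \<in> {1..n}"
        "\<And>u. insert (?N, u) F \<in> \<F> \<Longrightarrow> u \<in> {1..n} \<Longrightarrow> u \<notin> etop ` F \<Longrightarrow> False"
    | "G = F"
    using Suc.prems(2)[OF G(1)] G by (cases rule: inc_forest_Suc_cases) metis+
  then show ?case
  proof cases
    case (1 u)
    \<comment> \<open>With \<open>Suc n\<close> first in its chain no edge into \<open>Suc n\<close>
      lies in the order, and a competing edge \<open>(Suc n, m)\<close> goes to a component minimum
      in the chain of \<open>u\<close>, where \<open>u\<close> is the only one.\<close>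
    let ?L = "L \<union> {?N} \<times> {x. x = u \<or> (x, u) \<in> L \<or> (u, x) \<in> L}"
    have "isolates ?N ?L (insert (?N, u) F) \<F>"
    proof (rule isolates_insert[OF LF Suc.prems(2)])
      show "chain_order ?L" by (rule chain_order_insert_first[OF L N 1(2)])
      show "?L \<subseteq> {1..?N} \<times> {1..?N}" using L(2) 1(2) by auto
      show "(?N, u) = (?N, m)" if "(?N, m) \<in> ?L" "m \<notin> etop ` F" for m
        using that 1 NL root by blast
    qed (use 1 NL new in auto)
    then show ?thesis by blast
  next
    case (2 b)
    let ?A = "{a \<in> {1..n}. insert (a, ?N) F \<in> \<F>}"
    have "finite L" using L(2) by (rule finite_subset) simp
    moreover have "acyclic L"
      using L(1) unfolding chain_order_def acyclic_irrefl by simp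
    ultimately have "wf L" by (rule finite_acyclic_wf)
    moreover have "b \<in> ?A" using 2 by simp
    ultimately obtain a where a: "a \<in> ?A" "\<And>x. (x, a) \<in> L \<Longrightarrow> x \<notin> ?A"
      by (rule wfE_min) blast
    \<comment> \<open>The tail of an edge into \<open>Suc n\<close> is now \<open>a\<close> or
      precedes \<open>a\<close>, and the latter are no candidates since \<open>a\<close> is
      \<open>L\<close>-minimal. Edges from \<open>Suc n\<close> to points behind \<open>a\<close>
      also lie in the order, which is why downward candidates were treated first.\<close>
    let ?L = "L \<union> {x. x = a \<or> (x, a) \<in> L} \<times> {?N} \<union> {?N} \<times> {y. (a, y) \<in> L}"
    have "isolates ?N ?L (insert (a, ?N) F) \<F>"
    proof (rule isolates_insert[OF LF Suc.prems(2)])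
      show "chain_order ?L" by (rule chain_order_insert_after[OF L N]) (use a in simp)
      show "?L \<subseteq> {1..?N} \<times> {1..?N}" using L(2) a(1) by auto
      show "(a, ?N) = (x, ?N)" if "(x, ?N) \<in> ?L" "insert (x, ?N) F \<in> \<F>" "x \<in> {1..n}" for x
        using that a NL by auto
      show "(a, ?N) = (?N, m)" if "insert (?N, m) F \<in> \<F>" "m \<in> {1..n}" "m \<notin> etop ` F" for m
        using 2(3)[OF that] by blast
    qed (use a NL new in auto)
    then show ?thesis by blast
  next
    case 3
    \<comment> \<open>Here \<open>F\<close> itself belongs to the family and the order is kept:
      \<open>Suc n\<close> is incomparable to everything, so a member inside \<open>L\<close> has no
      edge there.\<close>
    have sub: "F' \<inter> gens n = F'" if "F' \<in> \<F>" "F' \<subseteq> L" for F'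
    proof -
      have "F' \<subseteq> gens ?N" using Suc.prems(2)[OF that(1)] by (simp add: inc_forest_def)
      then show ?thesis using that(2) L(2) by (fastforce simp: gens_def)
    qed
    have "card F' < card F" if "F' \<in> \<F>" "F' \<subseteq> L" "F' \<noteq> F" for F'
    proof -
      have "F' \<in> (\<lambda>F. F \<inter> gens n) ` \<F>"
        using sub[OF that(1,2)] that(1) by (metis image_eqI)
      then show ?thesis using LF that unfolding isolates_def by blast
    qed
    moreover have "L \<subseteq> {1..?N} \<times> {1..?N}" using L(2) by auto
    ultimately have "isolates ?N L F \<F>"
      using LF 3 G(1) unfolding isolates_def by blast
    then show ?thesis by blast
  qed
qed

section \<open>Action on the exterior algebra of the vertices\<close>

text \<open>Left multiplication by \<open>x_a\<close> in the exterior algebra on the vertices, an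
  element being given by its coefficients; the sign moves \<open>x_a\<close> past the smaller
  indices.\<close>

definition create :: "nat \<Rightarrow> (nat set \<Rightarrow> rat) \<Rightarrow> nat set \<Rightarrow> rat" where
  "create a m = (\<lambda>S. if a \<in> S then (-1) ^ card {j \<in> S. j < a} * m (S - {a}) else 0)"

lemma create_add: "create a (x + y) = create a x + create a y"
  by (simp add: create_def fun_eq_iff plus_fun_apply distrib_left)

lemma create_diff: "create a (x - y) = create a x - create a y"
  by (simp add: create_def fun_eq_iff right_diff_distrib)

lemma create_scale: "create a (scale c x) = scale c (create a x)"
  by (simp add: create_def scale_def fun_eq_iff)

lemma create_zero: "create a 0 = 0"
  by (simp add: create_def fun_eq_iff zero_fun_apply)

lemma create_same: "create a (create a x) = 0"
  by (simp add: create_def fun_eq_iff zero_fun_apply)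

lemma create_swap: "create a (create b x) = - create b (create a x)"
proof (induction a b rule: linorder_wlog)
  case (le a b)
  show ?case
  proof (cases "a = b")
    case True
    then show ?thesis by (simp add: create_same)
  next
    case False
    then have ab: "a < b" using le by simp
    show ?thesis
    proof
      fix S
      show "create a (create b x) S = (- create b (create a x)) S"
      proof (cases "a \<in> S \<and> b \<in> S")
        case True
        \<comment> \<open>Removing \<open>a\<close> lowers the count for \<open>b\<close> by one,
          while removing \<open>b\<close> leaves the count for \<open>a\<close> unchanged; this is
          the sign.\<close>
        have "{j \<in> S. j < b} = insert a {j \<in> S - {a}. j < b}" using True ab by auto
        then have "card {j \<in> S. j < b} = Suc (card {j \<in> S - {a}. j < b})" by simp
        moreover have "{j \<in> S - {b}. j < a} = {j \<in> S. j < a}" using ab by auto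
        moreover have "S - {b} - {a} = S - {a} - {b}" by blast
        ultimately show ?thesis using True ab by (simp add: create_def)
      qed (auto simp: create_def)
    qed
  qed
next
  case (sym a b)
  then show ?case by simp
qed

definition edge_op :: "edge set \<Rightarrow> edge \<Rightarrow> (nat set \<Rightarrow> rat) \<Rightarrow> nat set \<Rightarrow> rat" where
  "edge_op L e m = (if e \<in> L then create (snd e) m - create (fst e) m else 0)"

lemma edge_op_scale: "edge_op L e (scale c m) = scale c (edge_op L e m)"
  by (simp add: edge_op_def create_scale scale_diff_right)

lemma edge_op_add: "edge_op L e (x + y) = edge_op L e x + edge_op L e y"
  by (simp add: edge_op_def create_add)

lemma edge_op_zero [simp]: "edge_op L e 0 = 0"
  by (simp add: edge_op_def create_zero)

lemma edge_op_swap: "edge_op L e (edge_op L f m) = - edge_op L f (edge_op L e m)"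
  by (simp add: edge_op_def create_diff create_zero create_swap[of "snd e"] create_swap[of "fst e"])

lemma edge_op_same: "edge_op L e (edge_op L e m) = 0"
  by (simp add: edge_op_def create_diff create_zero create_same create_swap[of "snd e" "fst e"])

text \<open>Edges are sorted lexicographically, which is the order of \<open>egt\<close>, with the
  least edge outermost; hence the operators multiply with the signs of
  \<open>ex_sign\<close>.\<close>

definition act_mono :: "edge set \<Rightarrow> edge set \<Rightarrow> (nat set \<Rightarrow> rat) \<Rightarrow> nat set \<Rightarrow> rat" where
  "act_mono L A m = foldr (edge_op L) (sorted_list_of_set A) m"

lemma foldr_edge_op_scale:
  "foldr (edge_op L) es (scale c m) = scale c (foldr (edge_op L) es m)"
  by (induction es) (simp_all add: edge_op_scale)

lemma foldr_edge_op_add: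
  "foldr (edge_op L) es (x + y) = foldr (edge_op L) es x + foldr (edge_op L) es y"
  by (induction es) (simp_all add: edge_op_add)

lemma foldr_edge_op_zero: "foldr (edge_op L) es 0 = 0"
  by (induction es) simp_all

lemma edge_op_foldr_mem: "e \<in> set es \<Longrightarrow> edge_op L e (foldr (edge_op L) es m) = 0"
proof (induction es)
  case (Cons f fs)
  show ?case
  proof (cases "e = f")
    case True
    then show ?thesis by (simp add: edge_op_same)
  next
    case False
    then have "edge_op L f (edge_op L e (foldr (edge_op L) fs m)) = 0" using Cons by simp
    then show ?thesis by (simp add: edge_op_swap[of L e f])
  qed
qed simp

text \<open>Anticommutation moves \<open>e\<close> inwards past the smaller edges to its sorted
  place, at the cost of one sign for each.\<close>

lemma edge_op_foldr:
  assumes "sorted es" "distinct es" "e \<notin> set es"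
  shows "edge_op L e (foldr (edge_op L) es m) =
    scale ((-1) ^ card {f \<in> set es. f < e}) (foldr (edge_op L) (insort e es) m)"
  using assms
proof (induction es)
  case (Cons f fs)
  show ?case
  proof (cases "e \<le> f")
    case True
    then have none: "{g. (g = f \<or> g \<in> set fs) \<and> g < e} = {}" using Cons.prems by auto
    show ?thesis using True by (simp add: none)
  next
    case False
    let ?B = "{g \<in> set fs. g < e}"
    have "{g \<in> set (f # fs). g < e} = insert f ?B" using False by auto
    moreover have "f \<notin> ?B" using Cons.prems by auto
    ultimately have c: "card {g \<in> set (f # fs). g < e} = Suc (card ?B)" by simp
    have "edge_op L e (foldr (edge_op L) (f # fs) m) =
        - edge_op L f (edge_op L e (foldr (edge_op L) fs m))"
      by (simp add: edge_op_swap[of L e f])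
    also have "edge_op L e (foldr (edge_op L) fs m) =
        scale ((-1) ^ card ?B) (foldr (edge_op L) (insort e fs) m)"
      using Cons by auto
    also have "- edge_op L f \<dots> =
        scale ((-1) ^ Suc (card ?B)) (foldr (edge_op L) (insort e (f # fs)) m)"
      using False by (simp add: edge_op_scale) (simp add: scale_def fun_eq_iff)
    finally show ?thesis unfolding c .
  qed
qed simp

lemma ex_sign_single: "ex_sign {e} A = (-1) ^ card {f \<in> A. f < e}"
proof -
  have "{(a, b). a \<in> {e} \<and> b \<in> A \<and> egt a b} = Pair e ` {f \<in> A. f < e}"
    by (auto simp: egt_iff)
  moreover have "inj_on (Pair e) {f \<in> A. f < e}" by (simp add: inj_on_def)
  ultimately show ?thesis by (simp add: ex_sign_def card_image)
qed

lemma edge_op_act_mono: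
  assumes "finite A"
  shows "edge_op L e (act_mono L A m) =
    (if e \<in> A then 0 else scale (ex_sign {e} A) (act_mono L (insert e A) m))"
  using assms edge_op_foldr_mem[of e "sorted_list_of_set A" L m]
    edge_op_foldr[of "sorted_list_of_set A" e L m]
  by (simp add: act_mono_def ex_sign_single)

lemma act_mono_empty [simp]: "act_mono L {} m = m"
  by (simp add: act_mono_def)

lemma act_mono_insert_min:
  assumes "finite A" "\<And>a. a \<in> A \<Longrightarrow> e < a"
  shows "act_mono L (insert e A) m = edge_op L e (act_mono L A m)"
proof -
  have none: "{f \<in> A. f < e} = {}" "e \<notin> A" using assms(2) by fastforce+
  have "ex_sign {e} A = 1" unfolding ex_sign_single none(1) by simp
  then show ?thesis using assms(1) none(2) by (simp add: edge_op_act_mono)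
qed

lemma act_mono_scale: "act_mono L A (scale c m) = scale c (act_mono L A m)"
  by (simp add: act_mono_def foldr_edge_op_scale)

lemma act_mono_add: "act_mono L A (x + y) = act_mono L A x + act_mono L A y"
  by (simp add: act_mono_def foldr_edge_op_add)

lemma act_mono_zero [simp]: "act_mono L A 0 = 0"
  by (simp add: act_mono_def foldr_edge_op_zero)

text \<open>The counterpart of \<open>wedge_mono\<close> for operators. The induction adds edges to
  \<open>A\<close> below all present ones, so that the new edge is the outermost operator.\<close>

lemma act_mono_act_mono:
  assumes "finite A" "finite B"
  shows "act_mono L A (act_mono L B m) =
    (if A \<inter> B = {} then scale (ex_sign A B) (act_mono L (A \<union> B) m) else 0)"
  using assms(1)
proof (induction A rule: finite_linorder_min_induct)
  case empty
  then show ?case by simp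
next
  case (insert e A)
  have none: "{f \<in> A. f < e} = {}" "e \<notin> A" using insert.hyps by fastforce+
  have "ex_sign {e} A = 1" unfolding ex_sign_single none(1) by simp
  note e = none(2) this
  have step: "act_mono L (insert e A) (act_mono L B m) = edge_op L e (act_mono L A (act_mono L B m))"
    using insert.hyps by (intro act_mono_insert_min) auto
  show ?case
  proof (cases "insert e A \<inter> B = {}")
    case True
    have "ex_sign ({e} \<union> A) B = ex_sign {e} B * ex_sign A B"
      using e insert.hyps assms(2) by (intro ex_sign_Un_left) auto
    moreover have "ex_sign {e} (A \<union> B) = ex_sign {e} A * ex_sign {e} B"
      using True insert.hyps assms(2) by (intro ex_sign_Un_right) auto
    ultimately show ?thesis
      using True insert.hyps insert.IH assms(2) e
      by (simp add: step edge_op_scale edge_op_act_mono scale_scale mult.commute)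
  next
    case False
    then show ?thesis
      using insert.hyps insert.IH assms(2) by (auto simp: step edge_op_scale edge_op_act_mono)
  qed
qed

section \<open>The action of all elements and its vanishing on the ideal\<close>

definition act :: "nat \<Rightarrow> edge set \<Rightarrow> ext \<Rightarrow> (nat set \<Rightarrow> rat) \<Rightarrow> nat set \<Rightarrow> rat" where
  "act n L f m = (\<Sum>A\<in>Pow (gens n). scale (f A) (act_mono L A m))"

lemma act_add: "act n L (f + g) m = act n L f m + act n L g m"
  by (simp add: act_def plus_fun_apply scale_add_left sum.distrib)

lemma act_diff: "act n L (f - g) m = act n L f m - act n L g m"
proof -
  have "act n L ((f - g) + g) m = act n L (f - g) m + act n L g m" by (rule act_add)
  then show ?thesis by simp
qed

lemma act_scale: "act n L (scale c f) m = scale c (act n L f m)"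
  by (simp add: act_def scale_sum scale_scale scale_def[of c f])

lemma act_zero: "act n L 0 m = 0"
  by (simp add: act_def zero_fun_apply)

lemma act_sum: "act n L (\<Sum>i\<in>I. f i) m = (\<Sum>i\<in>I. act n L (f i) m)"
  by (induction I rule: infinite_finite_induct) (simp_all add: act_zero act_add)

lemma act_add_right: "act n L f (x + y) = act n L f x + act n L f y"
  by (simp add: act_def act_mono_add scale_add_right sum.distrib)

lemma act_scale_right: "act n L f (scale c x) = scale c (act n L f x)"
  by (simp add: act_def act_mono_scale scale_sum scale_scale mult.commute)

lemma act_zero_right [simp]: "act n L f 0 = 0"
  by (simp add: act_def)

lemma act_sum_right: "act n L f (\<Sum>i\<in>I. x i) = (\<Sum>i\<in>I. act n L f (x i))"
  by (induction I rule: infinite_finite_induct) (simp_all add: act_add_right)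

lemma act_ext_mono:
  assumes "A \<subseteq> gens n"
  shows "act n L (ext_mono A) m = act_mono L A m"
proof -
  have "act n L (ext_mono A) m = (\<Sum>B\<in>Pow (gens n). if B = A then act_mono L A m else 0)"
    unfolding act_def by (rule sum.cong) (auto simp: ext_mono_def)
  also have "\<dots> = act_mono L A m"
    using assms finite_gens by (simp add: sum.delta)
  finally show ?thesis .
qed

lemma wedge_sum_left: "wedge (\<Sum>i\<in>I. f i) g = (\<Sum>i\<in>I. wedge (f i) g)"
  by (induction I rule: infinite_finite_induct) (simp_all add: wedge_add_left)

lemma wedge_sum_right: "wedge f (\<Sum>i\<in>I. g i) = (\<Sum>i\<in>I. wedge f (g i))"
  by (induction I rule: infinite_finite_induct) (simp_all add: wedge_add_right)

text \<open>Both sides are bilinear in \<open>f\<close> and \<open>g\<close>, and for monomials the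
  claim is \<open>act_mono_act_mono\<close>.\<close>

lemma act_wedge:
  assumes "f \<in> ExtAlg n" "g \<in> ExtAlg n"
  shows "act n L (wedge f g) m = act n L f (act n L g m)"
proof -
  have mono: "act n L (wedge (ext_mono A) (ext_mono B)) m = act n L (ext_mono A) (act n L (ext_mono B) m)"
    if "A \<in> Pow (gens n)" "B \<in> Pow (gens n)" for A B
  proof -
    have "finite A" "finite B" using that finite_gens finite_subset by blast+
    then show ?thesis
      using that by (simp add: wedge_mono act_scale act_ext_mono act_mono_act_mono act_zero)
  qed
  let ?F = "\<Sum>A\<in>Pow (gens n). scale (f A) (ext_mono A)"
  let ?G = "\<Sum>B\<in>Pow (gens n). scale (g B) (ext_mono B)"
  have "act n L (wedge ?F ?G) m = (\<Sum>A\<in>Pow (gens n). \<Sum>B\<in>Pow (gens n).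
      scale (f A) (scale (g B) (act n L (wedge (ext_mono A) (ext_mono B)) m)))"
    by (simp only: wedge_sum_left wedge_scale_left act_sum act_scale)
      (simp only: wedge_sum_right wedge_scale_right act_sum act_scale scale_sum)
  also have "\<dots> = (\<Sum>A\<in>Pow (gens n). \<Sum>B\<in>Pow (gens n).
      scale (f A) (scale (g B) (act n L (ext_mono A) (act n L (ext_mono B) m))))"
    by (intro sum.cong refl) (simp only: mono)
  also have "\<dots> = act n L ?F (act n L ?G m)"
    unfolding act_sum[of n L "\<lambda>A. scale (f A) (ext_mono A)"] act_scale
    unfolding act_sum act_scale act_sum_right act_scale_right scale_sum ..
  finally have "act n L (wedge ?F ?G) m = act n L ?F (act n L ?G m)" .
  then show ?thesis by (simp only: flip: ext_expand[OF assms(1)] ext_expand[OF assms(2)])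
qed

lemma pvb_rels_ExtAlg:
  assumes "\<rho> \<in> pvb_rels n"
  shows "\<rho> \<in> ExtAlg n"
proof -
  have r: "r i j \<in> ExtAlg n" if "i \<in> {1..n}" "j \<in> {1..n}" "i \<noteq> j" for i j
    unfolding r_def using that by (intro ext_mono_in) (simp add: gens_def)
  have add: "ext_add x y \<in> ExtAlg n" and diff: "ext_diff x y \<in> ExtAlg n"
    if "x \<in> ExtAlg n" "y \<in> ExtAlg n" for x y
    using that unfolding ExtAlg_def ext_add_def ext_diff_def by force+
  show ?thesis
    using assms unfolding pvb_rels_def
    by (elim UnE CollectE exE conjE) (simp_all add: add diff ExtAlg_wedge r)
qed

text \<open>If \<open>i\<close> precedes both \<open>j\<close> and \<open>k\<close>, then these are
  comparable and the first relation becomes an identity such as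
  \<open>(x_j - x_i) (x_k - x_i) = (x_j - x_i) (x_k - x_j)\<close>, whose sides differ by a square.
  Otherwise, by transitivity, each term has an edge outside \<open>L\<close>. The second relation is
  dual, with \<open>i\<close> and \<open>j\<close> preceding \<open>k\<close>; the third holds by
  asymmetry of \<open>L\<close>.\<close>

lemma act_rel:
  assumes L: "chain_order L" and \<rho>: "\<rho> \<in> pvb_rels n"
  shows "act n L \<rho> m = 0"
proof -
  have rr: "act n L (wedge (r a b) (r c d)) m = edge_op L (a, b) (edge_op L (c, d) m)"
    if "a \<in> {1..n}" "b \<in> {1..n}" "c \<in> {1..n}" "d \<in> {1..n}" "a \<noteq> b" "c \<noteq> d" for a b c d
  proof -
    have g: "{(a, b)} \<subseteq> gens n" "{(c, d)} \<subseteq> gens n" using that by (auto simp: gens_def)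
    have single: "act_mono L {e} x = edge_op L e x" for e x
      using act_mono_insert_min[of "{}" e L x] by simp
    show ?thesis
      unfolding r_def act_wedge[OF ext_mono_in[OF g(1)] ext_mono_in[OF g(2)]]
        act_ext_mono[OF g(1)] act_ext_mono[OF g(2)] single ..
  qed
  note tr = chain_order_trans[OF L] and ir = chain_order_irrefl[OF L]
    and ou = chain_order_out[OF L] and inn = chain_order_in[OF L]
  note simps = edge_op_def create_diff create_zero create_same
  consider i j k where "i \<in> {1..n}" "j \<in> {1..n}" "k \<in> {1..n}" "i \<noteq> j" "i \<noteq> k" "j \<noteq> k"
      "\<rho> = ext_add (ext_diff (wedge (r i j) (r i k)) (wedge (r i j) (r j k))) (wedge (r i k) (r k j))"
    | i j k where "i \<in> {1..n}" "j \<in> {1..n}" "k \<in> {1..n}" "i \<noteq> j" "i \<noteq> k" "j \<noteq> k"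
      "\<rho> = ext_add (ext_diff (wedge (r i k) (r j k)) (wedge (r i j) (r j k))) (wedge (r j i) (r i k))"
    | i j where "i \<in> {1..n}" "j \<in> {1..n}" "i \<noteq> j" "\<rho> = wedge (r i j) (r j i)"
    using \<rho> unfolding pvb_rels_def by blast
  then show ?thesis
  proof cases
    case (1 i j k)
    have sw: "create j (create i m) = - create i (create j m)"
      "create k (create i m) = - create i (create k m)"
      "create k (create j m) = - create j (create k m)"
      by (rule create_swap)+
    have "act n L \<rho> m = edge_op L (i, j) (edge_op L (i, k) m)
        - edge_op L (i, j) (edge_op L (j, k) m) + edge_op L (i, k) (edge_op L (k, j) m)"
      unfolding 1(7) ext_add_eq ext_diff_eq act_add act_diff using 1(1-6) by (simp add: rr)
    moreover consider "(i, j) \<in> L" "(i, k) \<in> L" "(j, k) \<in> L" "(k, j) \<notin> L"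
      | "(i, j) \<in> L" "(i, k) \<in> L" "(k, j) \<in> L" "(j, k) \<notin> L"
      | "(i, k) \<notin> L" "(j, k) \<notin> L \<or> (i, j) \<notin> L"
      | "(i, j) \<notin> L" "(k, j) \<notin> L \<or> (i, k) \<notin> L"
      using tr[of i j k] tr[of i k j] ou[of i j k] tr[of j k j] ir[of j] 1(6) by blast
    ultimately show ?thesis
      by cases (auto simp: simps sw)
  next
    case (2 i j k)
    have sw: "create j (create i m) = - create i (create j m)"
      "create k (create i m) = - create i (create k m)"
      "create k (create j m) = - create j (create k m)"
      by (rule create_swap)+
    have "act n L \<rho> m = edge_op L (i, k) (edge_op L (j, k) m)
        - edge_op L (i, j) (edge_op L (j, k) m) + edge_op L (j, i) (edge_op L (i, k) m)"
      unfolding 2(7) ext_add_eq ext_diff_eq act_add act_diff using 2(1-6) by (simp add: rr)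
    moreover consider "(i, k) \<in> L" "(j, k) \<in> L" "(i, j) \<in> L" "(j, i) \<notin> L"
      | "(i, k) \<in> L" "(j, k) \<in> L" "(j, i) \<in> L" "(i, j) \<notin> L"
      | "(i, k) \<notin> L" "(j, k) \<notin> L \<or> (i, j) \<notin> L"
      | "(j, k) \<notin> L" "(j, i) \<notin> L \<or> (i, k) \<notin> L"
      using tr[of i j k] tr[of j i k] inn[of i k j] tr[of j i j] ir[of j] 2(4) by blast
    ultimately show ?thesis
      by cases (auto simp: simps sw)
  next
    case (3 i j)
    have "act n L \<rho> m = edge_op L (i, j) (edge_op L (j, i) m)"
      unfolding 3(4) using 3(1-3) by (simp add: rr)
    moreover have "(i, j) \<notin> L \<or> (j, i) \<notin> L" using tr[of i j i] ir by blast
    ultimately show ?thesis by (auto simp: simps)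
  qed
qed

lemma act_pvb_ideal:
  assumes "chain_order L" "f \<in> pvb_ideal n"
  shows "act n L f m = 0"
  using assms(2)
proof induction
  case zero
  then show ?case by (simp add: act_zero zero_ext_eq)
next
  case (gen \<rho> x y)
  then show ?case
    using act_rel[OF assms(1) gen(1)] pvb_rels_ExtAlg[OF gen(1)]
    by (simp add: act_wedge ExtAlg_wedge)
next
  case (add a b)
  then show ?case by (simp add: ext_add_eq act_add)
qed

section \<open>Coefficients of the action on the unit, and independence\<close>

definition vacuum :: "nat set \<Rightarrow> rat" where
  "vacuum = (\<lambda>S. if S = {} then 1 else 0)"

text \<open>Each edge multiplies by 0 or by a linear form in its endpoints, so the result is
  homogeneous of degree \<open>card A\<close> in the vertices that occur.\<close>

lemma act_mono_support:
  assumes "finite A" "act_mono L A vacuum X \<noteq> 0"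
  shows "finite X" "card X = card A" "A \<subseteq> gens n \<Longrightarrow> X \<subseteq> {1..n}"
proof -
  have "finite X \<and> card X = length es \<and> (set es \<subseteq> gens n \<longrightarrow> X \<subseteq> {1..n})"
    if "foldr (edge_op L) es vacuum X \<noteq> 0" for es
    using that
  proof (induction es arbitrary: X)
    case Nil
    then show ?case by (auto simp: vacuum_def split: if_splits)
  next
    case (Cons e es)
    let ?m = "foldr (edge_op L) es vacuum"
    have "edge_op L e ?m X \<noteq> 0" using Cons.prems by simp
    moreover have "edge_op L e ?m X = 0" if "create (snd e) ?m X = 0" "create (fst e) ?m X = 0"
      using that by (simp add: edge_op_def[of L e ?m] zero_fun_apply)
    ultimately have "create (snd e) ?m X \<noteq> 0 \<or> create (fst e) ?m X \<noteq> 0" by blast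
    then obtain x where e: "x \<in> {fst e, snd e}" and "create x ?m X \<noteq> 0" by blast
    then have "x \<in> X" "?m (X - {x}) \<noteq> 0"
      by (auto simp: create_def[of x ?m] split: if_splits)
    note x = e this
    note IH = Cons.IH[OF x(3)]
    have "finite X" using IH by simp
    moreover have "card X = Suc (card (X - {x}))"
      by (rule card.remove[OF \<open>finite X\<close> x(2)])
    moreover have "x \<in> {1..n}" if "e \<in> gens n" using that x(1) by (auto simp: gens_def)
    ultimately show ?case using IH by auto
  qed
  from this[of "sorted_list_of_set A"]
  show "finite X" "card X = card A" "A \<subseteq> gens n \<Longrightarrow> X \<subseteq> {1..n}"
    using assms by (auto simp: act_mono_def)
qed

lemma act_mono_outside:
  assumes "finite A" "\<not> A \<subseteq> L"
  shows "act_mono L A m = 0"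
proof -
  obtain e where e: "e \<in> A" "e \<notin> L" using assms(2) by blast
  have "edge_op L e x = 0" for x using e(2) by (simp add: edge_op_def)
  then have "foldr (edge_op L) es m = 0" if "e \<in> set es" for es
    using that by (induction es) auto
  then show ?thesis using e(1) assms(1) by (simp add: act_mono_def)
qed

text \<open>In the factor \<open>x_b - x_a\<close> of the edge at the largest vertex only the term
  of that vertex contributes, because the other edges do not reach it; the remaining coefficient is
  the one for the smaller forest.\<close>

lemma act_mono_top:
  assumes "inc_forest n F" "F \<subseteq> L"
  shows "act_mono L F vacuum (etop ` F) \<noteq> 0"
  using assms
proof (induction n arbitrary: F)
  case 0
  then have "F = {}" by (auto simp: inc_forest_def gens_def)
  then show ?case by (simp add: vacuum_def)
next
  case (Suc n)
  let ?N = "Suc n"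
  let ?F = "F \<inter> gens n"
  have F0: "inc_forest n ?F" "?F \<subseteq> L" "finite ?F" "?F \<subseteq> gens n"
    using inc_forest_Int[OF Suc.prems(1), of n] Suc.prems(2) inc_forest_finite[OF Suc.prems(1)] by auto
  let ?m = "act_mono L ?F vacuum"
  have IH: "?m (etop ` ?F) \<noteq> 0" using Suc.IH F0 by blast
  have N: "?N \<notin> etop ` ?F" using F0(4) etop_gens by fastforce
  have supp: "?m X = 0" if "?N \<in> X" for X
    using act_mono_support(3)[OF F0(3) _ F0(4)] that by fastforce
  \<comment> \<open>Removing \<open>a\<close> leaves \<open>Suc n\<close> in the set, where the
    image of the smaller forest has coefficient 0.\<close>
  have lower: "create a ?m (insert ?N (etop ` ?F)) = 0" if "a \<in> {1..n}" for a
    using that supp by (auto simp: create_def)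
  have upper: "create ?N ?m (insert ?N (etop ` ?F)) \<noteq> 0"
    using IH N by (simp add: create_def)
  have main: "act_mono L F vacuum (etop ` F) \<noteq> 0"
    if e: "F = insert e ?F" "e \<notin> ?F" "etop e = ?N"
      and ab: "e = (a, ?N) \<or> e = (?N, a)" "a \<in> {1..n}" for e a
  proof -
    have "e \<in> L" using e(1) Suc.prems(2) by blast
    have top: "etop ` F = insert ?N (etop ` ?F)" using e by (metis image_insert)
    have "edge_op L e ?m (etop ` F) \<noteq> 0"
      using \<open>e \<in> L\<close> ab upper lower[OF ab(2)] unfolding top by (auto simp: edge_op_def)
    moreover have "edge_op L e ?m = scale (ex_sign {e} ?F) (act_mono L F vacuum)"
      unfolding edge_op_act_mono[OF F0(3)] if_not_P[OF e(2)] using e(1) by simp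
    ultimately show ?thesis by (auto simp: scale_def)
  qed
  from Suc.prems(1) show ?case
  proof (cases rule: inc_forest_Suc_cases)
    case 1
    then show ?thesis using IH by simp
  next
    case (2 a)
    then show ?thesis by (intro main[of "(a, ?N)" a]) (auto simp: gens_def etop_def)
  next
    case (3 a)
    then show ?thesis by (intro main[of "(?N, a)" a]) (auto simp: gens_def etop_def)
  qed
qed

text \<open>For the family of forests with nonzero coefficient an isolating order acts on the unit,
  and the coefficient at the tops of the isolated forest \<open>F\<close> is read off. Other members
  of the family either leave \<open>L\<close> and act as 0, or have fewer edges and live in lower
  degree. What remains is \<open>c F\<close> times a nonzero number.\<close>

lemma forests_independent:
  assumes "(\<Sum>D\<in>up_down_forests n. scale (c D) (ext_mono D)) \<in> pvb_ideal n"
    and "D \<in> up_down_forests n"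
  shows "c D = 0"
proof (rule ccontr)
  assume "c D \<noteq> 0"
  define \<F> where "\<F> = {D \<in> up_down_forests n. c D \<noteq> 0}"
  have \<F>: "inc_forest n F" if "F \<in> \<F>" for F
    using that by (simp add: \<F>_def up_down_forests_eq)
  have "\<F> \<noteq> {}" using assms(2) \<open>c D \<noteq> 0\<close> by (auto simp: \<F>_def)
  then obtain L F where LF: "isolates n L F \<F>" using ex_isolates \<F> by blast
  then have L: "chain_order L" and F: "F \<in> \<F>" "F \<subseteq> L"
    and smaller: "\<And>F'. F' \<in> \<F> \<Longrightarrow> F' \<subseteq> L \<Longrightarrow> F' \<noteq> F \<Longrightarrow> card F' < card F"
    by (auto simp: isolates_def)
  let ?X = "etop ` F"
  have cardX: "card ?X = card F"
    using \<F>[OF F(1)] by (simp add: inc_forest_def card_image)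
  have coef: "c G * act_mono L G vacuum ?X = (if G = F then c F * act_mono L F vacuum ?X else 0)"
    if G: "G \<in> up_down_forests n" for G
  proof (cases "G = F \<or> c G = 0")
    case False
    then have "G \<in> \<F>" using G by (simp add: \<F>_def)
    then have fin: "finite G" using \<F> inc_forest_finite by blast
    have "act_mono L G vacuum ?X = 0"
    proof (cases "G \<subseteq> L")
      case True
      then have "card G < card ?X" using smaller \<open>G \<in> \<F>\<close> False cardX by simp
      then show ?thesis using act_mono_support(2)[OF fin] by (metis nat_less_le)
    next
      case False
      then show ?thesis using act_mono_outside[OF fin] by (simp add: zero_fun_apply)
    qed
    then show ?thesis using False by simp
  qed auto
  have "0 = act n L (\<Sum>D\<in>up_down_forests n. scale (c D) (ext_mono D)) vacuum ?X"
    using act_pvb_ideal[OF L assms(1)] by (simp add: zero_fun_apply)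
  also have "\<dots> = (\<Sum>G\<in>up_down_forests n. c G * act_mono L G vacuum ?X)"
    unfolding act_sum act_scale sum_apply
    by (rule sum.cong) (auto simp: up_down_forests_eq inc_forest_def act_ext_mono scale_def)
  also have "\<dots> = (\<Sum>G\<in>up_down_forests n. if G = F then c F * act_mono L F vacuum ?X else 0)"
    by (rule sum.cong) (simp_all only: coef)
  also have "\<dots> = c F * act_mono L F vacuum ?X"
    using F(1) finite_inc_forests by (simp add: \<F>_def up_down_forests_eq)
  finally show False
    using act_mono_top[OF \<F>[OF F(1)] F(2)] F(1) by (simp add: \<F>_def)
qed

theorem theorem5p15:
  fixes n :: nat
  shows "(\<forall>x\<in>ExtAlg n. \<exists>c :: edge set \<Rightarrow> rat.
            ext_diff x (\<lambda>A. \<Sum>D\<in>up_down_forests n. c D * ext_mono D A) \<in> pvb_ideal n)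
       \<and> (\<forall>c :: edge set \<Rightarrow> rat.
            (\<lambda>A. \<Sum>D\<in>up_down_forests n. c D * ext_mono D A) \<in> pvb_ideal n
              \<longrightarrow> (\<forall>D\<in>up_down_forests n. c D = 0))"
proof -
  \<comment> \<open>The pointwise sums of the statement are turned into sums of functions.\<close>
  have eq: "(\<lambda>A. \<Sum>D\<in>up_down_forests n. c D * ext_mono D A) =
      (\<Sum>D\<in>up_down_forests n. scale (c D) (ext_mono D))" for c
    by (simp add: fun_eq_iff sum_apply scale_def)
  show ?thesis
    unfolding eq ext_diff_eq
    using ExtAlg_spanned[of _ n] forests_independent[of _ n] unfolding spanned_def by blast
qed

end
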